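(* Fix an integer $d \ge 1$. For each integer $L \ge 1$ let $B_L = \{0, \dots, L\}^d$ be the box of side length $L$ in $\mathbf{Z}^d$, regarded as a graph, and let $\lambda_{\mathrm{IP}}(B_L)$ be the spectral gap for the interchange process on $B_L$. Then $\lambda_{\mathrm{IP}}(B_L)$ is asymptotic to $\pi^2/L^2$ as $L \to \infty$, that is, $$\lim_{L \to \infty} \frac{L^2}{\pi^2}\, \lambda_{\mathrm{IP}}(B_L) = 1 .$$
   Context: The box $B_L = \{0,\dots,L\}^d$ is the graph with this vertex set in which two vertices are joined by an edge exactly when they are nearest neighbours in $\mathbf{Z}^d$ (they differ by $1$ in exactly one coordinate and agree in the others). Interchange process. Let $G$ be a connected, undirected graph with $n$ vertices labeled $1,\dots,n$, and take $n$ particles labeled $1,\dots,n$. A configuration places exactly one particle at each vertex; it is identified with a permutation $\pi$ of $\{1,\dots,n\}$, where $\pi(i)=j$ means that particle $i$ is at vertex $j$. The interchange process on $G$ is the continuous-time Markov chain on the $n!$ configurations in which, for each edge $(i,j)$ of $G$, at rate $1$ the particles at vertices $i$ and $j$ are interchanged. Spectral gap. For a continuous-time Markov chain on a finite state space $W$ with symmetric transition rate matrix $Q$ (off-diagonal entries are the transition rates, rows sum to $0$), irreducible, the spectral gap is the minimum value of $\alpha>0$ such that $Qf = -\alpha f$ for some nonzero $f: W \to \mathbf{R}$. *)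

theory Defs
  imports Complex_Main "HOL-Library.FuncSet" "HOL-Combinatorics.Permutations"
begin

text \<open>
  A continuous-time Markov chain on a finite state space \<open>W\<close> is given by its transition rates
  \<open>r x y\<close> for \<open>x \<noteq> y\<close>; the values \<open>r x x\<close> are irrelevant.
\<close>

definition rate_matrix :: "'s set \<Rightarrow> ('s \<Rightarrow> 's \<Rightarrow> real) \<Rightarrow> 's \<Rightarrow> 's \<Rightarrow> real" where
  "rate_matrix W r x y = (if x = y then - (\<Sum>z\<in>W - {x}. r x z) else r x y)"

text \<open>
  Functions on \<open>W\<close> are represented by functions on the whole type, of which only the values
  on \<open>W\<close> matter; in particular ``nonzero'' means nonzero somewhere on \<open>W\<close>. The minimum is
  only meaningful if it is attained, which is the case for finite \<open>W\<close> with at least two elements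
  and symmetric irreducible \<open>Q\<close>.
\<close>

definition spectral_gap :: "'s set \<Rightarrow> ('s \<Rightarrow> 's \<Rightarrow> real) \<Rightarrow> real" where
  "spectral_gap W Q = (LEAST \<alpha>. \<alpha> > 0 \<and>
     (\<exists>f :: 's \<Rightarrow> real. (\<exists>x\<in>W. f x \<noteq> 0) \<and>
        (\<forall>x\<in>W. (\<Sum>y\<in>W. Q x y * f y) = - \<alpha> * f x)))"

text \<open>
  A graph is a vertex set \<open>V\<close> with a set \<open>E\<close> of edges, which are two-element subsets of \<open>V\<close>.
  Particles carry the same labels as vertices, and we let the vertices be their own labels:
  a configuration is a permutation \<open>\<pi>\<close> of \<open>V\<close>, and \<open>\<pi> i = j\<close> means that particle \<open>i\<close> is at
  vertex \<open>j\<close>. Interchanging the particles at \<open>i\<close> and \<open>j\<close> therefore composes \<open>\<pi>\<close> on the left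
  with the transposition of \<open>i\<close> and \<open>j\<close>.
\<close>

definition ip_configs :: "'v set \<Rightarrow> ('v \<Rightarrow> 'v) set" where
  "ip_configs V = {\<pi>. \<pi> permutes V}"

definition ip_rate :: "'v set set \<Rightarrow> ('v \<Rightarrow> 'v) \<Rightarrow> ('v \<Rightarrow> 'v) \<Rightarrow> real" where
  "ip_rate E \<pi> \<sigma> = real (card {e \<in> E. \<exists>i j. e = {i, j} \<and> \<sigma> = transpose i j \<circ> \<pi>})"

definition ip_gap :: "'v set \<Rightarrow> 'v set set \<Rightarrow> real" where
  "ip_gap V E = spectral_gap (ip_configs V) (rate_matrix (ip_configs V) (ip_rate E))"

text \<open>
  Points of \<open>\<int>\<^sup>d\<close> are functions on the index set \<open>{..<d}\<close> (\<open>undefined\<close> elsewhere).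
\<close>

definition box_vertices :: "nat \<Rightarrow> nat \<Rightarrow> (nat \<Rightarrow> int) set" where
  "box_vertices d L = {..<d} \<rightarrow>\<^sub>E {0..int L}"

definition nearest_neighbours :: "nat \<Rightarrow> (nat \<Rightarrow> int) \<Rightarrow> (nat \<Rightarrow> int) \<Rightarrow> bool" where
  "nearest_neighbours d x y \<longleftrightarrow>
     (\<exists>k<d. \<bar>x k - y k\<bar> = 1 \<and> (\<forall>l<d. l \<noteq> k \<longrightarrow> x l = y l))"

definition box_edges :: "nat \<Rightarrow> nat \<Rightarrow> (nat \<Rightarrow> int) set set" where
  "box_edges d L =
     {{x, y} | x y. x \<in> box_vertices d L \<and> y \<in> box_vertices d L \<and> nearest_neighbours d x y}"

end

theory Submission
  imports Defs "HOL-Analysis.Convex" "HOL-Real_Asymp.Real_Asymp"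
begin

text \<open>
Write \<open>\<theta> = \<pi> / (L + 1)\<close>. Evaluating \<open>cos (\<theta> (x\<^sub>0 + 1/2))\<close> at the position \<open>x\<close> of a single particle
  gives an eigenfunction of the interchange process on the box with eigenvalue
  \<open>2 - 2 cos \<theta> \<sim> \<pi>\<^sup>2 / L\<^sup>2\<close>, which bounds the gap from above. The work is in the lower bound, which
  is obtained in the form of a Poincare inequality \<open>\<parallel>f\<parallel>\<^sup>2 \<le> K \<E>(f)\<close> for functions \<open>f\<close> of mean zero, with
  a constant \<open>K = L\<^sup>2/\<pi>\<^sup>2 + O(L)\<close>; every positive eigenvalue is then at least \<open>1/K\<close>.

  The mechanism is the argument of Handjani and Jungreis. Split \<open>f = u + r\<close>, where \<open>u\<close> is a sum
  of functions of the position of one particle and \<open>r\<close> sums to zero over the configurations with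
  particle \<open>i\<close> at vertex \<open>x\<close>, for all \<open>i\<close> and \<open>x\<close>. The two parts are orthogonal both in
  \<open>\<ell>\<^sup>2\<close> and for the Dirichlet form. On \<open>u\<close> the Poincare inequality of the simple random walk
  applies. For \<open>r\<close>, condition on the particle that sits at a chosen vertex \<open>v\<close>: what remains is a function of
  mean zero for the interchange process on the graph without \<open>v\<close>. Hence
  (\<open>ip_poincare_vertex_step\<close>) a constant that works for the random walk on \<open>V\<close> and for the interchange
  process on \<open>V - {v}\<close> works for the interchange process on \<open>V\<close>. Building the box vertex by vertex,
  it suffices to have a Poincare inequality with the constant \<open>K\<close> for the random walk on every
  intermediate graph.

  The intermediate graphs are boxes with side lengths \<open>k\<close> and \<open>k + 1\<close>, together with an
  arbitrary part of one further layer. For a box, the constant of the longest side is inherited by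
  tensorization (\<open>box_poincare\<close>), and the sharp constant of a path with \<open>N\<close> vertices is
  \<open>1 / (2 - 2 cos (\<pi>/N))\<close> (\<open>path_poincare\<close>). Adding part of a layer costs only \<open>O(k)\<close>, which is negligible
  against \<open>k\<^sup>2/\<pi>\<^sup>2\<close> (\<open>box_with_layer_poincare\<close>): each new vertex hangs off a vertex on the
  face of the box, and the sum of \<open>f\<^sup>2\<close> over a face is at most of order \<open>1/k\<close> times the sum
  over the box plus \<open>k\<close> times the energy. All these constants are dominated by the one for
  \<open>k = L\<close>.
\<close>

section \<open>Removing one vertex from the interchange process\<close>

text \<open>
  The Dirichlet form of the random walk with rates \<open>w\<close>; every edge appears as two ordered pairs,
  whence the factor \<open>1/2\<close>.
\<close>

definition rw_form :: "'v set \<Rightarrow> ('v \<Rightarrow> 'v \<Rightarrow> real) \<Rightarrow> ('v \<Rightarrow> real) \<Rightarrow> real" where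
  "rw_form V w g = (\<Sum>x\<in>V. \<Sum>y\<in>V. w x y * (g x - g y)\<^sup>2) / 2"

text \<open>
  The polarized Dirichlet form of the interchange process with rates \<open>w\<close> for the uniform
  weight. The factor is \<open>1/4\<close> because every edge appears as two ordered pairs and every transition
  is seen from both of its endpoints.
\<close>

definition ip_form ::
  "'v set \<Rightarrow> ('v \<Rightarrow> 'v \<Rightarrow> real) \<Rightarrow> (('v \<Rightarrow> 'v) \<Rightarrow> real) \<Rightarrow> (('v \<Rightarrow> 'v) \<Rightarrow> real) \<Rightarrow> real" where
  "ip_form V w f g = (\<Sum>\<pi> | \<pi> permutes V. \<Sum>x\<in>V. \<Sum>y\<in>V.
     w x y * ((f (transpose x y \<circ> \<pi>) - f \<pi>) * (g (transpose x y \<circ> \<pi>) - g \<pi>))) / 4"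

definition rw_poincare :: "'v set \<Rightarrow> ('v \<Rightarrow> 'v \<Rightarrow> real) \<Rightarrow> real \<Rightarrow> bool" where
  "rw_poincare V w K \<longleftrightarrow> (\<forall>g. (\<Sum>x\<in>V. g x) = 0 \<longrightarrow> (\<Sum>x\<in>V. (g x)\<^sup>2) \<le> K * rw_form V w g)"

definition ip_poincare :: "'v set \<Rightarrow> ('v \<Rightarrow> 'v \<Rightarrow> real) \<Rightarrow> real \<Rightarrow> bool" where
  "ip_poincare V w K \<longleftrightarrow> (\<forall>f. (\<Sum>\<pi> | \<pi> permutes V. f \<pi>) = 0 \<longrightarrow>
     (\<Sum>\<pi> | \<pi> permutes V. (f \<pi>)\<^sup>2) \<le> K * ip_form V w f f)"

text \<open>
  The negative of the generator, a positive semidefinite operator for nonnegative rates.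
\<close>

definition ip_gen ::
  "'v set \<Rightarrow> ('v \<Rightarrow> 'v \<Rightarrow> real) \<Rightarrow> (('v \<Rightarrow> 'v) \<Rightarrow> real) \<Rightarrow> ('v \<Rightarrow> 'v) \<Rightarrow> real" where
  "ip_gen V w f \<pi> = (\<Sum>x\<in>V. \<Sum>y\<in>V. w x y * (f \<pi> - f (transpose x y \<circ> \<pi>))) / 2"

definition laplacian :: "'v set \<Rightarrow> ('v \<Rightarrow> 'v \<Rightarrow> real) \<Rightarrow> ('v \<Rightarrow> real) \<Rightarrow> 'v \<Rightarrow> real" where
  "laplacian V w g x = (\<Sum>y\<in>V. w x y * (g x - g y))"

text \<open>
  Up to normalization, the conditional expectation of \<open>f\<close> given that particle \<open>i\<close> is at \<open>x\<close>.
\<close>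

definition one_particle :: "'v set \<Rightarrow> (('v \<Rightarrow> 'v) \<Rightarrow> real) \<Rightarrow> 'v \<Rightarrow> 'v \<Rightarrow> real" where
  "one_particle V f i x = (\<Sum>\<pi> | \<pi> permutes V \<and> \<pi> i = x. f \<pi>)"

lemma sum_permutes_transpose_comp:
  assumes "x \<in> V" "y \<in> V"
  shows "(\<Sum>\<pi> | \<pi> permutes V. F (transpose x y \<circ> \<pi>)) = (\<Sum>\<pi> | \<pi> permutes V. F \<pi>)"
  by (rule sum.reindex_bij_witness[where i="\<lambda>\<pi>. transpose x y \<circ> \<pi>" and j="\<lambda>\<pi>. transpose x y \<circ> \<pi>"])
     (auto simp: o_assoc intro!: permutes_compose permutes_swap_id assms)

text \<open>
  Relabelling the particles by the transposition of \<open>i\<close> and \<open>x\<close> turns the configurations with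
  particle \<open>i\<close> at \<open>x\<close> into those with particle \<open>x\<close> at \<open>x\<close>, which are the permutations of the other
  vertices. The relabelling acts on the right and commutes with the moves, which act on the left.
\<close>

lemma sum_permutes_pinned:
  assumes "i \<in> V" "x \<in> V"
  shows "(\<Sum>\<pi> | \<pi> permutes V \<and> \<pi> i = x. F \<pi>) =
    (\<Sum>\<sigma> | \<sigma> permutes (V - {x}). F (\<sigma> \<circ> transpose i x))"
proof (rule sum.reindex_bij_witness[where i="\<lambda>\<sigma>. \<sigma> \<circ> transpose i x" and j="\<lambda>\<sigma>. \<sigma> \<circ> transpose i x"])
  fix \<pi> assume "\<pi> \<in> {\<pi>. \<pi> permutes V \<and> \<pi> i = x}"
  then have p: "\<pi> permutes V" "\<pi> i = x" by auto
  have q: "\<pi> \<circ> transpose i x permutes V"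
    by (intro permutes_compose permutes_swap_id assms p)
  show "\<pi> \<circ> transpose i x \<in> {\<sigma>. \<sigma> permutes V - {x}}"
    using permutes_superset[OF q, of "V - {x}"] p by auto
  show "(\<pi> \<circ> transpose i x) \<circ> transpose i x = \<pi>" by (simp add: comp_assoc)
  show "F ((\<pi> \<circ> transpose i x) \<circ> transpose i x) = F \<pi>" by (simp add: comp_assoc)
next
  fix \<sigma> assume "\<sigma> \<in> {\<sigma>. \<sigma> permutes V - {x}}"
  then have s: "\<sigma> permutes V - {x}" by auto
  have "\<sigma> permutes V" using permutes_subset[OF s] by auto
  then have "\<sigma> \<circ> transpose i x permutes V"
    by (intro permutes_compose permutes_swap_id assms)
  moreover have "\<sigma> x = x" using s by (simp add: permutes_def)
  ultimately show "\<sigma> \<circ> transpose i x \<in> {\<pi>. \<pi> permutes V \<and> \<pi> i = x}" by auto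
  show "(\<sigma> \<circ> transpose i x) \<circ> transpose i x = \<sigma>" by (simp add: comp_assoc)
qed

lemma sum_permutes_by_image:
  assumes "finite V" "i \<in> V"
  shows "(\<Sum>x\<in>V. \<Sum>\<pi> | \<pi> permutes V \<and> \<pi> i = x. F \<pi>) = (\<Sum>\<pi> | \<pi> permutes V. F \<pi>)"
proof -
  have "(\<Sum>x\<in>V. sum F {\<pi> \<in> {\<pi>. \<pi> permutes V}. \<pi> i = x}) = sum F {\<pi>. \<pi> permutes V}"
    using assms by (intro sum.group) (auto simp: finite_permutations permutes_in_image)
  then show ?thesis by simp
qed

lemma sum_permutes_by_preimage:
  assumes "finite V" "x \<in> V"
  shows "(\<Sum>i\<in>V. \<Sum>\<pi> | \<pi> permutes V \<and> \<pi> i = x. F \<pi>) = (\<Sum>\<pi> | \<pi> permutes V. F \<pi>)"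
proof -
  have "(\<Sum>i\<in>V. sum F {\<pi> \<in> {\<pi>. \<pi> permutes V}. inv \<pi> x = i}) = sum F {\<pi>. \<pi> permutes V}"
    using assms by (intro sum.group) (auto simp: finite_permutations permutes_in_image permutes_inv)
  moreover have "{\<pi> \<in> {\<pi>. \<pi> permutes V}. inv \<pi> x = i} = {\<pi>. \<pi> permutes V \<and> \<pi> i = x}" for i
    by (auto simp: permutes_inv_eq permutes_inverses)
  ultimately show ?thesis by simp
qed

lemma sum_permutes_eval:
  assumes "finite V" "i \<in> V"
  shows "(\<Sum>\<pi> | \<pi> permutes V. g (\<pi> i)) = fact (card V - 1) * (\<Sum>x\<in>V. g x :: real)"
proof -
  have "(\<Sum>\<pi> | \<pi> permutes V. g (\<pi> i)) = (\<Sum>x\<in>V. \<Sum>\<pi> | \<pi> permutes V \<and> \<pi> i = x. g (\<pi> i))"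
    by (rule sum_permutes_by_image[symmetric]) (use assms in auto)
  also have "\<dots> = (\<Sum>x\<in>V. \<Sum>\<sigma> | \<sigma> permutes (V - {x}). g x)"
  proof (rule sum.cong[OF refl])
    fix x assume "x \<in> V"
    then show "(\<Sum>\<pi> | \<pi> permutes V \<and> \<pi> i = x. g (\<pi> i)) = (\<Sum>\<sigma> | \<sigma> permutes (V - {x}). g x)"
      by (subst sum_permutes_pinned[OF assms(2)]) (auto simp: permutes_def)
  qed
  also have "\<dots> = (\<Sum>x\<in>V. fact (card V - 1) * g x)"
    using assms(1) by (intro sum.cong refl) (simp add: card_permutations[of _ "card V - 1"])
  finally show ?thesis by (simp add: sum_distrib_left)
qed

lemma sum_mult_one_particle:
  assumes "finite V"
  shows "(\<Sum>\<pi> | \<pi> permutes V. (\<Sum>i\<in>V. h i (\<pi> i)) * f \<pi>) =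
    (\<Sum>i\<in>V. \<Sum>x\<in>V. h i x * one_particle V f i x)"
proof -
  have "(\<Sum>\<pi> | \<pi> permutes V. (\<Sum>i\<in>V. h i (\<pi> i)) * f \<pi>)
      = (\<Sum>i\<in>V. \<Sum>\<pi> | \<pi> permutes V. h i (\<pi> i) * f \<pi>)"
    by (simp add: sum_distrib_right sum.swap[of _ _ V])
  also have "\<dots> = (\<Sum>i\<in>V. \<Sum>x\<in>V. \<Sum>\<pi> | \<pi> permutes V \<and> \<pi> i = x. h i (\<pi> i) * f \<pi>)"
    using assms by (intro sum.cong refl sum_permutes_by_image[symmetric])
  also have "\<dots> = (\<Sum>i\<in>V. \<Sum>x\<in>V. h i x * one_particle V f i x)"
    by (simp add: one_particle_def sum_distrib_left)
  finally show ?thesis .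
qed

text \<open>
  The positions of two particles are almost independent: given particle \<open>i\<close> at \<open>x\<close>, another particle
  is uniform on the remaining vertices. For coefficients with vanishing row and column sums the
  resulting corrections add up, so that superposing the functions \<open>h j\<close> multiplies the one-particle
  averages by a constant. This inverts the projection to functions of one particle.
\<close>

lemma one_particle_superposition:
  assumes fin: "finite V" and n: "card V \<ge> 2" and i: "i \<in> V" and x: "x \<in> V"
    and rows: "\<And>j. j \<in> V \<Longrightarrow> (\<Sum>y\<in>V. h j y) = 0"
    and cols: "\<And>y. y \<in> V \<Longrightarrow> (\<Sum>j\<in>V. h j y) = 0"
  shows "one_particle V (\<lambda>\<pi>. \<Sum>j\<in>V. h j (\<pi> j)) i x = real (card V) * fact (card V - 2) * h i x"
proof -
  let ?n = "card V"
  have other: "(\<Sum>\<pi> | \<pi> permutes V \<and> \<pi> i = x. h j (\<pi> j)) = - fact (?n - 2) * h j x"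
    if j: "j \<in> V - {i}" for j
  proof -
    have j': "transpose i x j \<in> V - {x}"
      using j i x by (auto simp: transpose_def)
    have "(\<Sum>\<pi> | \<pi> permutes V \<and> \<pi> i = x. h j (\<pi> j)) =
        (\<Sum>\<sigma> | \<sigma> permutes (V - {x}). h j (\<sigma> (transpose i x j)))"
      by (subst sum_permutes_pinned[OF i x]) simp
    also have "\<dots> = fact (card (V - {x}) - 1) * (\<Sum>y\<in>V - {x}. h j y)"
      using fin j' by (intro sum_permutes_eval) auto
    also have "(\<Sum>y\<in>V - {x}. h j y) = - h j x"
      using rows[of j] j fin x by (simp add: sum.remove[OF fin x])
    also have "card (V - {x}) - 1 = ?n - 2" using fin x by simp
    finally show ?thesis by simp
  qed
  have same: "(\<Sum>\<pi> | \<pi> permutes V \<and> \<pi> i = x. h i (\<pi> i)) = fact (?n - 1) * h i x"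
  proof -
    have "(\<Sum>\<pi> | \<pi> permutes V \<and> \<pi> i = x. h i (\<pi> i)) = (\<Sum>\<sigma> | \<sigma> permutes (V - {x}). h i x)"
      by (subst sum_permutes_pinned[OF i x]) (auto simp: permutes_def)
    also have "\<dots> = fact (?n - 1) * h i x"
      using fin x by (simp add: card_permutations[of _ "?n - 1"])
    finally show ?thesis .
  qed
  have "one_particle V (\<lambda>\<pi>. \<Sum>j\<in>V. h j (\<pi> j)) i x
      = (\<Sum>j\<in>V. \<Sum>\<pi> | \<pi> permutes V \<and> \<pi> i = x. h j (\<pi> j))"
    unfolding one_particle_def by (rule sum.swap)
  also have "\<dots> = fact (?n - 1) * h i x + (\<Sum>j\<in>V - {i}. - fact (?n - 2) * h j x)"
    by (simp only: sum.remove[OF fin i] same other cong: sum.cong)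
  also have "(\<Sum>j\<in>V - {i}. - fact (?n - 2) * h j x) = - fact (?n - 2) * (\<Sum>j\<in>V - {i}. h j x)"
    by (simp only: sum_distrib_left)
  also have "(\<Sum>j\<in>V - {i}. h j x) = - h i x"
    using cols[OF x] by (simp add: sum.remove[OF fin i])
  also have "fact (?n - 1) = real (?n - 1) * fact (?n - 2)"
    using n fact_reduce[of "?n - 1", where 'a=real] by (simp add: numeral_2_eq_2)
  finally show ?thesis using n by (simp add: algebra_simps of_nat_diff)
qed

lemma ip_form_eq_gen:
  assumes "finite V"
  shows "ip_form V w f g = (\<Sum>\<pi> | \<pi> permutes V. ip_gen V w f \<pi> * g \<pi>)"
proof -
  let ?P = "{\<pi>. \<pi> permutes V}"
  have edge: "(\<Sum>\<pi>\<in>?P. (f (transpose x y \<circ> \<pi>) - f \<pi>) * (g (transpose x y \<circ> \<pi>) - g \<pi>))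
      = 2 * (\<Sum>\<pi>\<in>?P. (f \<pi> - f (transpose x y \<circ> \<pi>)) * g \<pi>)" if "x \<in> V" "y \<in> V" for x y
  proof -
    let ?t = "\<lambda>\<pi>. transpose x y \<circ> \<pi>"
    have "(\<Sum>\<pi>\<in>?P. (f (?t \<pi>) - f \<pi>) * g (?t \<pi>)) = (\<Sum>\<pi>\<in>?P. (f \<pi> - f (?t \<pi>)) * g \<pi>)"
      using sum_permutes_transpose_comp[OF that, of "\<lambda>\<pi>. (f \<pi> - f (?t \<pi>)) * g \<pi>"]
      by (simp add: o_assoc)
    moreover have "(f (?t \<pi>) - f \<pi>) * (g (?t \<pi>) - g \<pi>) =
        (f (?t \<pi>) - f \<pi>) * g (?t \<pi>) + (f \<pi> - f (?t \<pi>)) * g \<pi>" for \<pi>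
      by (simp add: algebra_simps)
    ultimately show ?thesis by (simp add: sum.distrib)
  qed
  have sw: "(\<Sum>\<pi>\<in>?P. \<Sum>x\<in>V. \<Sum>y\<in>V. H \<pi> x y) = (\<Sum>x\<in>V. \<Sum>y\<in>V. \<Sum>\<pi>\<in>?P. H \<pi> x y)" for H :: "_ \<Rightarrow> _ \<Rightarrow> _ \<Rightarrow> real"
    by (simp add: sum.swap[of _ V ?P])
  have "ip_form V w f g = (\<Sum>x\<in>V. \<Sum>y\<in>V. w x y *
      (\<Sum>\<pi>\<in>?P. (f (transpose x y \<circ> \<pi>) - f \<pi>) * (g (transpose x y \<circ> \<pi>) - g \<pi>))) / 4"
    unfolding ip_form_def by (simp only: sw sum_distrib_left)
  also have "\<dots> = (\<Sum>x\<in>V. \<Sum>y\<in>V. w x y * (2 * (\<Sum>\<pi>\<in>?P. (f \<pi> - f (transpose x y \<circ> \<pi>)) * g \<pi>))) / 4"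
    by (simp add: edge)
  also have "\<dots> = (\<Sum>x\<in>V. \<Sum>y\<in>V. \<Sum>\<pi>\<in>?P. w x y * ((f \<pi> - f (transpose x y \<circ> \<pi>)) * g \<pi>)) / 2"
    unfolding sum_distrib_left sum_divide_distrib by (intro sum.cong refl) simp
  also have "\<dots> = (\<Sum>\<pi>\<in>?P. ip_gen V w f \<pi> * g \<pi>)"
    unfolding ip_gen_def sum_divide_distrib sum_distrib_right sw
    by (intro sum.cong refl) simp
  finally show ?thesis .
qed

lemma rw_form_eq_laplacian:
  assumes "\<And>x y. w x y = w y x"
  shows "rw_form V w g = (\<Sum>x\<in>V. laplacian V w g x * g x)"
proof -
  have "(\<Sum>x\<in>V. \<Sum>y\<in>V. w x y * (g x - g y)\<^sup>2)
     = (\<Sum>x\<in>V. \<Sum>y\<in>V. w x y * (g x - g y) * g x) + (\<Sum>x\<in>V. \<Sum>y\<in>V. w x y * (g y - g x) * g y)"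
    unfolding sum.distrib[symmetric] by (intro sum.cong refl) (simp add: power2_eq_square algebra_simps)
  also have "(\<Sum>x\<in>V. \<Sum>y\<in>V. w x y * (g y - g x) * g y) = (\<Sum>x\<in>V. \<Sum>y\<in>V. w x y * (g x - g y) * g x)"
    by (subst sum.swap) (simp add: assms)
  finally show ?thesis
    by (simp add: rw_form_def laplacian_def sum_distrib_right)
qed

text \<open>
  One particle of the interchange process performs a random walk.
\<close>

lemma ip_gen_single:
  assumes fin: "finite V" and sym: "\<And>x y. w x y = w y x" and i: "\<pi> i \<in> V"
  shows "ip_gen V w (\<lambda>\<pi>. g (\<pi> i)) \<pi> = laplacian V w g (\<pi> i)"
proof -
  let ?z = "\<pi> i"
  have "(\<Sum>x\<in>V. \<Sum>y\<in>V. w x y * (g ?z - g (transpose x y ?z))) =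
     (\<Sum>x\<in>V. \<Sum>y\<in>V. (if x = ?z then w x y * (g ?z - g y) else 0) + (if y = ?z then w x y * (g ?z - g x) else 0))"
    by (intro sum.cong refl) (auto simp: transpose_def)
  also have "\<dots> = (\<Sum>x\<in>V. if x = ?z then (\<Sum>y\<in>V. w x y * (g ?z - g y)) else 0) + laplacian V w g ?z"
  proof -
    have "(\<Sum>y\<in>V. if x = ?z then w x y * (g ?z - g y) else 0)
        = (if x = ?z then (\<Sum>y\<in>V. w x y * (g ?z - g y)) else 0)" for x
      by simp
    moreover have "(\<Sum>x\<in>V. \<Sum>y\<in>V. if y = ?z then w x y * (g ?z - g x) else 0) = laplacian V w g ?z"
      using fin i by (simp add: laplacian_def sym[of _ ?z])
    ultimately show ?thesis by (simp only: sum.distrib)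
  qed
  also have "\<dots> = 2 * laplacian V w g ?z"
    using fin i by (simp add: laplacian_def)
  finally show ?thesis by (simp add: ip_gen_def)
qed

lemma ip_gen_sum:
  "ip_gen V w (\<lambda>\<pi>. \<Sum>i\<in>I. F i \<pi>) \<pi> = (\<Sum>i\<in>I. ip_gen V w (F i) \<pi>)"
  unfolding ip_gen_def sum_divide_distrib[symmetric]
  by (simp add: sum_subtractf[symmetric] sum_distrib_left sum.swap[of _ _ I])

text \<open>
  The step of Handjani and Jungreis. The part \<open>u\<close> of \<open>f\<close> that is visible in the one-particle averages
  is governed by the random walk on \<open>V\<close>. The rest \<open>r\<close> has mean zero on each class of
  configurations with a given particle at \<open>v\<close>, and each such class with the moves that avoid
  \<open>v\<close> is a copy of the interchange process on \<open>V - {v}\<close>.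
\<close>

lemma ip_poincare_vertex_step:
  assumes fin: "finite V" and n: "card V \<ge> 2" and v: "v \<in> V"
    and sym: "\<And>x y. w x y = w y x" and nonneg: "\<And>x y. w x y \<ge> 0" and K: "K \<ge> 0"
    and rw: "rw_poincare V w K" and ip: "ip_poincare (V - {v}) w K"
  shows "ip_poincare V w K"
  unfolding ip_poincare_def
proof (intro allI impI)
  fix f :: "('a \<Rightarrow> 'a) \<Rightarrow> real"
  let ?P = "{\<pi>. \<pi> permutes V}"
  assume f0: "(\<Sum>\<pi>\<in>?P. f \<pi>) = 0"
  \<comment> \<open>The normalization for which \<open>u\<close> has the same one-particle averages as \<open>f\<close>.\<close>
  define c where "c = 1 / (real (card V) * fact (card V - 2))"
  define h where "h = one_particle V f"
  define u where "u = (\<lambda>\<pi>. c * (\<Sum>i\<in>V. h i (\<pi> i)))"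
  define r where "r = (\<lambda>\<pi>. f \<pi> - u \<pi>)"
  have c: "c \<ge> 0" by (simp add: c_def)
  have rows: "(\<Sum>x\<in>V. h i x) = 0" if "i \<in> V" for i
    unfolding h_def one_particle_def using sum_permutes_by_image[OF fin that, of f] f0 by simp
  have cols: "(\<Sum>i\<in>V. h i x) = 0" if "x \<in> V" for x
    unfolding h_def one_particle_def using sum_permutes_by_preimage[OF fin that, of f] f0 by simp
  have u_h: "one_particle V u i x = h i x" if "i \<in> V" "x \<in> V" for i x
  proof -
    have "one_particle V u i x = c * one_particle V (\<lambda>\<pi>. \<Sum>j\<in>V. h j (\<pi> j)) i x"
      by (simp add: one_particle_def u_def sum_distrib_left)
    also have "\<dots> = h i x"
      using one_particle_superposition[OF fin n that, of h] rows cols n by (simp add: c_def)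
    finally show ?thesis .
  qed
  have r_h: "one_particle V r i x = 0" if "i \<in> V" "x \<in> V" for i x
    using u_h[OF that] by (simp add: one_particle_def r_def sum_subtractf h_def)
  have gen_u: "ip_gen V w u \<pi> = c * (\<Sum>i\<in>V. laplacian V w (h i) (\<pi> i))" if "\<pi> \<in> ?P" for \<pi>
  proof -
    have "ip_gen V w u \<pi> = c * ip_gen V w (\<lambda>\<pi>. \<Sum>i\<in>V. h i (\<pi> i)) \<pi>"
      unfolding ip_gen_def u_def by (simp add: sum_distrib_left algebra_simps)
    also have "\<dots> = c * (\<Sum>i\<in>V. laplacian V w (h i) (\<pi> i))"
      unfolding ip_gen_sum using that by (simp add: ip_gen_single fin sym permutes_in_image)
    finally show ?thesis .
  qed
  have form_u: "ip_form V w u g = c * (\<Sum>i\<in>V. \<Sum>x\<in>V. laplacian V w (h i) x * one_particle V g i x)" for g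
    unfolding ip_form_eq_gen[OF fin]
    using sum_mult_one_particle[OF fin, of "\<lambda>i. laplacian V w (h i)" g]
    by (simp add: gen_u mult.assoc sum_distrib_left[symmetric])
  have inner_u: "(\<Sum>\<pi>\<in>?P. u \<pi> * g \<pi>) = c * (\<Sum>i\<in>V. \<Sum>x\<in>V. h i x * one_particle V g i x)" for g
    using sum_mult_one_particle[OF fin, of h g]
    by (simp add: u_def mult.assoc sum_distrib_left[symmetric])
  have u_le: "(\<Sum>\<pi>\<in>?P. (u \<pi>)\<^sup>2) \<le> K * ip_form V w u u"
  proof -
    have "(\<Sum>\<pi>\<in>?P. (u \<pi>)\<^sup>2) = c * (\<Sum>i\<in>V. \<Sum>x\<in>V. (h i x)\<^sup>2)"
      using inner_u[of u] by (simp add: u_h power2_eq_square)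
    also have "\<dots> \<le> c * (\<Sum>i\<in>V. K * rw_form V w (h i))"
      using rw rows c by (intro mult_left_mono sum_mono) (auto simp: rw_poincare_def)
    also have "\<dots> = K * ip_form V w u u"
      by (simp add: form_u u_h rw_form_eq_laplacian[OF sym] sum_distrib_left mult_ac)
    finally show ?thesis .
  qed
  have r_le: "(\<Sum>\<pi>\<in>?P. (r \<pi>)\<^sup>2) \<le> K * ip_form V w r r"
  proof -
    let ?V' = "V - {v}"
    \<comment> \<open>The copy of the smaller process in which particle \<open>i\<close> is frozen at \<open>v\<close>.\<close>
    define R where "R i = (\<lambda>\<sigma>. r (\<sigma> \<circ> transpose i v))" for i
    have pin: "(\<Sum>\<pi>\<in>?P. F \<pi>) = (\<Sum>i\<in>V. \<Sum>\<sigma> | \<sigma> permutes ?V'. F (\<sigma> \<circ> transpose i v))" for F :: "_ \<Rightarrow> real"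
      unfolding sum_permutes_by_preimage[OF fin v, symmetric]
      by (intro sum.cong refl sum_permutes_pinned v)
    have "(\<Sum>\<sigma> | \<sigma> permutes ?V'. R i \<sigma>) = 0" if "i \<in> V" for i
      using r_h[OF that v] by (simp add: one_particle_def sum_permutes_pinned[OF that v] R_def)
    then have "(\<Sum>\<pi>\<in>?P. (r \<pi>)\<^sup>2) \<le> (\<Sum>i\<in>V. K * ip_form ?V' w (R i) (R i))"
      unfolding pin using ip by (intro sum_mono) (auto simp: ip_poincare_def R_def)
    also have "\<dots> = K * ((\<Sum>\<pi>\<in>?P. \<Sum>x\<in>?V'. \<Sum>y\<in>?V'. w x y * (r (transpose x y \<circ> \<pi>) - r \<pi>)\<^sup>2) / 4)"
      unfolding pin ip_form_def by (simp add: R_def comp_assoc power2_eq_square sum_distrib_left sum_divide_distrib)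
    also have "\<dots> \<le> K * ((\<Sum>\<pi>\<in>?P. \<Sum>x\<in>V. \<Sum>y\<in>V. w x y * (r (transpose x y \<circ> \<pi>) - r \<pi>)\<^sup>2) / 4)"
    proof (intro mult_left_mono K divide_right_mono sum_mono)
      fix \<pi>
      have "(\<Sum>x\<in>?V'. \<Sum>y\<in>?V'. w x y * (r (transpose x y \<circ> \<pi>) - r \<pi>)\<^sup>2)
          \<le> (\<Sum>x\<in>?V'. \<Sum>y\<in>V. w x y * (r (transpose x y \<circ> \<pi>) - r \<pi>)\<^sup>2)"
        using fin nonneg by (intro sum_mono sum_mono2) auto
      also have "\<dots> \<le> (\<Sum>x\<in>V. \<Sum>y\<in>V. w x y * (r (transpose x y \<circ> \<pi>) - r \<pi>)\<^sup>2)"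
        using fin nonneg by (intro sum_mono2 sum_nonneg) auto
      finally show "(\<Sum>x\<in>?V'. \<Sum>y\<in>?V'. w x y * (r (transpose x y \<circ> \<pi>) - r \<pi>)\<^sup>2)
          \<le> (\<Sum>x\<in>V. \<Sum>y\<in>V. w x y * (r (transpose x y \<circ> \<pi>) - r \<pi>)\<^sup>2)" .
    qed simp
    also have "\<dots> = K * ip_form V w r r" by (simp add: ip_form_def power2_eq_square)
    finally show ?thesis .
  qed
  have f: "f = (\<lambda>\<pi>. u \<pi> + r \<pi>)" by (simp add: r_def)
  have "(\<Sum>\<pi>\<in>?P. (f \<pi>)\<^sup>2) = (\<Sum>\<pi>\<in>?P. (u \<pi>)\<^sup>2) + (\<Sum>\<pi>\<in>?P. (r \<pi>)\<^sup>2) + 2 * (\<Sum>\<pi>\<in>?P. u \<pi> * r \<pi>)"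
    unfolding f by (simp add: power2_sum sum.distrib sum_distrib_left mult.assoc)
  also have "(\<Sum>\<pi>\<in>?P. u \<pi> * r \<pi>) = 0" by (simp add: inner_u r_h)
  also have "ip_form V w f f = ip_form V w u u + ip_form V w r r + 2 * ip_form V w u r"
  proof -
    have "w x y * ((f (transpose x y \<circ> \<pi>) - f \<pi>) * (f (transpose x y \<circ> \<pi>) - f \<pi>)) =
        w x y * ((u (transpose x y \<circ> \<pi>) - u \<pi>) * (u (transpose x y \<circ> \<pi>) - u \<pi>)) +
        w x y * ((r (transpose x y \<circ> \<pi>) - r \<pi>) * (r (transpose x y \<circ> \<pi>) - r \<pi>)) +
        2 * (w x y * ((u (transpose x y \<circ> \<pi>) - u \<pi>) * (r (transpose x y \<circ> \<pi>) - r \<pi>)))" for x y \<pi>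
      unfolding f by (simp add: algebra_simps)
    then show ?thesis
      by (simp only: ip_form_def sum.distrib sum_distrib_left[symmetric] add_divide_distrib)
  qed
  moreover have "ip_form V w u r = 0" by (simp add: form_u r_h)
  ultimately show "(\<Sum>\<pi>\<in>?P. (f \<pi>)\<^sup>2) \<le> K * ip_form V w f f"
    using u_le r_le by (simp add: algebra_simps)
qed

lemma ip_poincare_singleton: "ip_poincare {v} w K"
  by (simp add: ip_poincare_def ip_form_def permutes_sing)

lemma ip_poincare_chain:
  assumes "finite T" and "finite B" "B \<noteq> {}" "B \<inter> T = {}"
    and sym: "\<And>x y. w x y = w y x" and nonneg: "\<And>x y. w x y \<ge> 0" and K: "K \<ge> 0"
    and ip: "ip_poincare B w K"
    and rw: "\<And>S. S \<subseteq> T \<Longrightarrow> rw_poincare (B \<union> S) w K"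
  shows "ip_poincare (B \<union> T) w K"
  using assms(1,4) rw
proof (induction T rule: finite_induct)
  case empty
  then show ?case using ip by simp
next
  case (insert v T)
  have "card (B \<union> insert v T) = Suc (card (B \<union> T))"
    using insert.hyps insert.prems(1) assms(2) by simp
  moreover have "card (B \<union> T) \<noteq> 0" using insert.hyps assms(2,3) by simp
  ultimately have n: "card (B \<union> insert v T) \<ge> 2" by linarith
  have eq: "B \<union> insert v T - {v} = B \<union> T" using insert.hyps insert.prems(1) by auto
  have ip': "ip_poincare (B \<union> T) w K"
    using insert.prems(1) by (intro insert.IH insert.prems(2)) auto
  have fin: "finite (B \<union> insert v T)" using insert.hyps assms(2) by simp
  have rw': "rw_poincare (B \<union> insert v T) w K" by (rule insert.prems(2)) simp
  show ?case
    by (rule ip_poincare_vertex_step[of _ v, OF fin n _ sym nonneg K rw']) (simp_all only: eq ip' insertI1 UnI2)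
qed

section \<open>The sharp Poincare inequality on a path\<close>

text \<open>
  The inverse of the spectral gap of the path with \<open>n \<ge> 2\<close> vertices.
\<close>

definition path_const :: "nat \<Rightarrow> real" where
  "path_const n = 1 / (2 - 2 * cos (pi / real n))"

lemma cos_pi_div_less_1: "n > 0 \<Longrightarrow> cos (pi / real n) < 1"
proof -
  assume n: "n > 0"
  have "cos (pi / real n) < cos 0"
    using n by (intro cos_monotone_0_pi) (auto simp: field_simps)
  then show ?thesis by simp
qed

lemma path_const_pos: "n > 0 \<Longrightarrow> path_const n > 0"
  using cos_pi_div_less_1 by (simp add: path_const_def)

lemma path_const_mono:
  assumes "0 < m" "m \<le> n"
  shows "path_const m \<le> path_const n"
proof -
  have "cos (pi / real m) \<le> cos (pi / real n)"
    using assms by (intro cos_monotone_0_pi_le) (auto simp: frac_le field_simps)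
  then show ?thesis
    unfolding path_const_def using cos_pi_div_less_1[of n] assms by (intro divide_left_mono mult_pos_pos) auto
qed

text \<open>
  A crude bound of the right order, enough for the error terms: \<open>2 - 2 cos (2y) = 4 sin\<^sup>2 y\<close> with
  \<open>sin y \<ge> y/2\<close>.
\<close>

lemma path_const_le:
  assumes "n \<ge> 2"
  shows "path_const n \<le> (real n)\<^sup>2"
proof -
  define y where "y = pi / (2 * real n)"
  have y: "0 < y" "y \<le> 1"
    using assms pi_less_4 by (auto simp: y_def field_simps)
  have "sin y \<ge> y / 2"
  proof -
    have "\<bar>sin y - y\<bar> \<le> y ^ 3 / 6"
      using Maclaurin_sin_bound[of y 3] y by (simp add: sin_coeff_def eval_nat_numeral)
    moreover have "y ^ 3 \<le> y" using y by (simp add: power3_eq_cube mult_le_one mult_left_le)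
    ultimately show ?thesis using y by linarith
  qed
  then have "(sin y)\<^sup>2 \<ge> (y/2)\<^sup>2" using y by (intro power_mono) auto
  moreover have "2 - 2 * cos (pi / real n) = 4 * (sin y)\<^sup>2"
    using cos_double_sin[of y] assms by (simp add: y_def)
  moreover have "y\<^sup>2 * (real n)\<^sup>2 = pi\<^sup>2/4" using assms by (simp add: y_def power_divide power_mult_distrib)
  moreover have "pi\<^sup>2 \<ge> 2\<^sup>2" using pi_ge_two by (intro power_mono) auto
  ultimately have "(2 - 2 * cos (pi / real n)) * (real n)\<^sup>2 \<ge> 1"
    using mult_right_mono[of "y\<^sup>2" "2 - 2 * cos (pi / real n)" "(real n)\<^sup>2"]
    by (simp add: power_divide)
  then show ?thesis
    using cos_pi_div_less_1[of n] assms unfolding path_const_def by (simp add: field_simps)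
qed

text \<open>
  The ground state \<open>s i = sin (i \<pi> / n)\<close> is positive inside the interval, so Picone's inequality
  \<open>(y - x)\<^sup>2 \<ge> x\<^sup>2 (1 - q/p) + y\<^sup>2 (1 - p/q)\<close> for \<open>p, q > 0\<close> can be applied with neighbouring values of
  \<open>s\<close>; the terms at each vertex add up to the eigenvalue of \<open>s\<close>.
\<close>

lemma dirichlet_path_poincare:
  fixes G :: "nat \<Rightarrow> real"
  assumes n: "n > 0" and G: "G 0 = 0" "G n = 0"
  shows "(\<Sum>i<n. (G i)\<^sup>2) \<le> path_const n * (\<Sum>i<n. (G (Suc i) - G i)\<^sup>2)"
proof -
  define \<theta> where "\<theta> = pi / real n"
  define s where "s i = sin (real i * \<theta>)" for i
  have s_pos: "s i > 0" if "0 < i" "i < n" for i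
    unfolding s_def \<theta>_def using that by (intro sin_gt_zero) (auto simp: field_simps)
  have s_rec: "s (Suc (Suc i)) + s i = 2 * cos \<theta> * s (Suc i)" for i
  proof -
    have "s (Suc (Suc i)) = sin (real (Suc i) * \<theta> + \<theta>)" "s i = sin (real (Suc i) * \<theta> - \<theta>)"
      by (auto simp: s_def algebra_simps)
    then show ?thesis by (simp add: sin_add sin_diff s_def)
  qed
  \<comment> \<open>\<open>a i\<close> and \<open>b i\<close> are the shares of the left and the right endpoint of the edge \<open>{i, i + 1}\<close>. The
    sine vanishes at \<open>0\<close> and \<open>n\<close>, where \<open>G\<close> vanishes as well and the share is set to zero.\<close>
  define a where "a i = (if i = 0 then 0 else (G i)\<^sup>2 * (1 - s (Suc i) / s i))" for i
  define b where "b i = (if Suc i = n then 0 else (G (Suc i))\<^sup>2 * (1 - s i / s (Suc i)))" for i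
  have edge: "(G (Suc i) - G i)\<^sup>2 \<ge> a i + b i" if "i < n" for i
  proof -
    have "Suc i = n \<or> Suc i < n" using that by auto
    then consider "i = 0" "Suc i = n" | "i = 0" "Suc i < n" | "i > 0" "Suc i = n" | "i > 0" "Suc i < n"
      by blast
    then show ?thesis
    proof cases
      case 1 then show ?thesis by (simp add: a_def b_def)
    next
      case 2 then show ?thesis by (simp add: a_def b_def G s_def)
    next
      case 3
      then have "s (Suc i) = 0" using n by (simp add: s_def \<theta>_def)
      then show ?thesis using 3 G by (simp add: a_def b_def)
    next
      case 4
      let ?p = "s i" and ?q = "s (Suc i)" and ?x = "G i" and ?y = "G (Suc i)"
      have pq: "?p > 0" "?q > 0" using 4 by (auto intro: s_pos)
      have "(?y - ?x)\<^sup>2 - (?x\<^sup>2 * (1 - ?q / ?p) + ?y\<^sup>2 * (1 - ?p / ?q)) = (?q * ?x - ?p * ?y)\<^sup>2 / (?p * ?q)"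
        using pq by (simp add: field_simps power2_eq_square)
      also have "\<dots> \<ge> 0" using pq by simp
      finally show ?thesis using 4 by (simp add: a_def b_def)
    qed
  qed
  have node: "a (Suc i) + b i = (2 - 2 * cos \<theta>) * (G (Suc i))\<^sup>2" if "Suc i < n" for i
  proof -
    have "s (Suc i) > 0" using that by (intro s_pos) auto
    then have "s (Suc (Suc i)) / s (Suc i) + s i / s (Suc i) = 2 * cos \<theta>"
      unfolding add_divide_distrib[symmetric] s_rec by simp
    then have "(1 - s (Suc (Suc i)) / s (Suc i)) + (1 - s i / s (Suc i)) = 2 - 2 * cos \<theta>" by linarith
    then show ?thesis using that by (simp add: a_def b_def distrib_left[symmetric] mult.commute)
  qed
  obtain m where m: "n = Suc m" using n by (cases n) auto
  have "(2 - 2 * cos \<theta>) * (\<Sum>i<n. (G i)\<^sup>2) = (\<Sum>i<m. (2 - 2 * cos \<theta>) * (G (Suc i))\<^sup>2)"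
    unfolding m sum.lessThan_Suc_shift using G by (simp add: sum_distrib_left)
  also have "\<dots> = (\<Sum>i<m. a (Suc i) + b i)" using m by (intro sum.cong) (auto simp: node)
  also have "\<dots> = (\<Sum>i<n. a i) + (\<Sum>i<n. b i)"
    unfolding m sum.distrib sum.lessThan_Suc_shift[of a] sum.lessThan_Suc[of b]
    by (simp add: a_def b_def m)
  also have "\<dots> \<le> (\<Sum>i<n. (G (Suc i) - G i)\<^sup>2)"
    unfolding sum.distrib[symmetric] using edge by (intro sum_mono) auto
  finally show ?thesis
    using cos_pi_div_less_1[OF n] by (simp add: path_const_def \<theta>_def field_simps)
qed

text \<open>
  The partial sums \<open>G\<close> of \<open>f\<close> vanish at both ends. Summation by parts gives
  \<open>(\<Sum>f\<^sup>2)\<^sup>2 \<le> (\<Sum>G\<^sup>2) (\<Sum>(\<nabla>f)\<^sup>2)\<close>, and the Dirichlet inequality for \<open>G\<close>, whose increments are \<open>f\<close>,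
  bounds \<open>\<Sum>G\<^sup>2\<close> by a multiple of \<open>\<Sum>f\<^sup>2\<close>.
\<close>

lemma path_poincare:
  fixes f :: "nat \<Rightarrow> real"
  assumes n: "n > 0" and f0: "(\<Sum>i<n. f i) = 0"
  shows "(\<Sum>i<n. (f i)\<^sup>2) \<le> path_const n * (\<Sum>i<n - 1. (f (Suc i) - f i)\<^sup>2)"
proof -
  define G where "G i = (\<Sum>j<i. f j)" for i
  let ?F = "\<Sum>i<n. (f i)\<^sup>2" and ?E = "\<Sum>i<n - 1. (f (Suc i) - f i)\<^sup>2"
  obtain m where m: "n = Suc m" using n by (cases n) auto
  have parts: "(\<Sum>i<Suc k. (f i)\<^sup>2) = G (Suc k) * f k - (\<Sum>i<k. G (Suc i) * (f (Suc i) - f i))" for k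
    by (induction k) (simp_all add: G_def algebra_simps power2_eq_square)
  have F: "?F = - (\<Sum>i<m. G (Suc i) * (f (Suc i) - f i))"
    using parts[of m] f0 by (simp add: m G_def)
  have cs: "?F\<^sup>2 \<le> (\<Sum>i<m. (G (Suc i))\<^sup>2) * ?E"
    unfolding F power2_minus using Cauchy_Schwarz_ineq_sum[of "\<lambda>i. G (Suc i)" "\<lambda>i. f (Suc i) - f i" "{..<m}"]
    by (simp add: m)
  have E0: "?E \<ge> 0" and F0: "?F \<ge> 0" by (auto intro: sum_nonneg)
  have "(\<Sum>i<m. (G (Suc i))\<^sup>2) = (\<Sum>i<n. (G i)\<^sup>2)"
    unfolding m sum.lessThan_Suc_shift by (simp add: G_def)
  also have "\<dots> \<le> path_const n * ?F"
    using dirichlet_path_poincare[of n G] n f0 by (simp add: G_def)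
  finally have "(\<Sum>i<m. (G (Suc i))\<^sup>2) * ?E \<le> path_const n * ?F * ?E"
    using E0 by (rule mult_right_mono)
  with cs have "?F\<^sup>2 \<le> path_const n * ?F * ?E" by (rule order_trans)
  then have *: "?F * ?F \<le> ?F * (path_const n * ?E)"
    by (simp only: power2_eq_square[of ?F] mult.commute[of "path_const n"] mult.assoc)
  show ?thesis
  proof (cases "?F = 0")
    case True
    then show ?thesis using path_const_pos[OF n] E0 by simp
  next
    case False
    then have "?F > 0" using F0 by linarith
    with * show ?thesis by (rule mult_left_le_imp_le)
  qed
qed

section \<open>Boxes with part of an extra layer\<close>

definition box :: "nat set \<Rightarrow> (nat \<Rightarrow> nat) \<Rightarrow> (nat \<Rightarrow> int) set" where
  "box I s = (\<Pi>\<^sub>E i\<in>I. {0..int (s i)})"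

definition up :: "nat \<Rightarrow> (nat \<Rightarrow> int) \<Rightarrow> nat \<Rightarrow> int" where
  "up i x = x(i := x i + 1)"

text \<open>
  The energy of \<open>f\<close> on the edges of \<open>V\<close> in direction \<open>i\<close>.
\<close>

definition dir_form :: "(nat \<Rightarrow> int) set \<Rightarrow> nat \<Rightarrow> ((nat \<Rightarrow> int) \<Rightarrow> real) \<Rightarrow> real" where
  "dir_form V i f = (\<Sum>x\<in>V. if up i x \<in> V then (f (up i x) - f x)\<^sup>2 else 0)"

lemma finite_box: "finite I \<Longrightarrow> finite (box I s)"
  unfolding box_def by (rule finite_PiE) auto

lemma card_box_pos:
  assumes "finite I" shows "card (box I s) > 0"
proof -
  have "(\<lambda>i. if i \<in> I then 0 else undefined) \<in> box I s"
    by (auto simp: box_def PiE_def extensional_def)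
  then show ?thesis using finite_box[OF assms] card_gt_0_iff by blast
qed

lemma up_in_box_iff: "i \<in> I \<Longrightarrow> x \<in> box I s \<Longrightarrow> up i x \<in> box I s \<longleftrightarrow> x i < int (s i)"
  unfolding box_def up_def PiE_def Pi_def extensional_def by (auto split: if_splits)

lemma dir_form_nonneg: "dir_form V i f \<ge> 0"
  unfolding dir_form_def by (auto intro!: sum_nonneg)

lemma dir_form_shift: "dir_form V i (\<lambda>x. f x - c) = dir_form V i f"
proof -
  have "f (up i x) - c - (f x - c) = f (up i x) - f x" for x by simp
  then show ?thesis by (simp only: dir_form_def)
qed

lemma inj_up: "inj (up i)"
proof (rule injI)
  fix x y assume *: "up i x = up i y"
  show "x = y"
  proof
    fix k show "x k = y k" using fun_cong[OF *, of k] by (cases "k = i") (auto simp: up_def)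
  qed
qed

lemma sum_box_insert:
  assumes "i \<notin> I"
  shows "(\<Sum>x\<in>box (insert i I) s. F x) = (\<Sum>r\<in>box I s. \<Sum>t\<in>{0..int (s i)}. F (r(i := t)))"
proof -
  have "(\<Sum>x\<in>box (insert i I) s. F x) =
      (\<Sum>p\<in>{0..int (s i)} \<times> box I s. F ((\<lambda>(t, r). r(i := t)) p))"
    unfolding box_def PiE_insert_eq
    using inj_combinator[OF assms, of "\<lambda>i. {0..int (s i)}"] by (subst sum.reindex) (auto simp: o_def)
  also have "\<dots> = (\<Sum>t\<in>{0..int (s i)}. \<Sum>r\<in>box I s. F (r(i := t)))"
    by (simp add: sum.cartesian_product split_beta)
  finally show ?thesis by (subst sum.swap)
qed

lemma dir_form_box_new:
  assumes "i \<notin> I"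
  shows "dir_form (box (insert i I) s) i f =
    (\<Sum>r\<in>box I s. \<Sum>t\<in>{0..int (s i)}. if t < int (s i) then (f (r(i := t + 1)) - f (r(i := t)))\<^sup>2 else 0)"
proof -
  have "dir_form (box (insert i I) s) i f =
      (\<Sum>x\<in>box (insert i I) s. if x i < int (s i) then (f (up i x) - f x)\<^sup>2 else 0)"
    unfolding dir_form_def by (intro sum.cong refl) (simp add: up_in_box_iff)
  then show ?thesis by (simp add: sum_box_insert[OF assms] up_def cong: if_cong)
qed

lemma dir_form_box_old:
  assumes "i \<notin> I" "k \<in> I"
  shows "dir_form (box (insert i I) s) k f = (\<Sum>t\<in>{0..int (s i)}. dir_form (box I s) k (\<lambda>r. f (r(i := t))))"
proof -
  have ki: "k \<noteq> i" using assms by auto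
  have "dir_form (box (insert i I) s) k f =
      (\<Sum>x\<in>box (insert i I) s. if x k < int (s k) then (f (up k x) - f x)\<^sup>2 else 0)"
    unfolding dir_form_def using assms by (intro sum.cong refl) (simp add: up_in_box_iff)
  also have "\<dots> = (\<Sum>r\<in>box I s. \<Sum>t\<in>{0..int (s i)}.
      if r k < int (s k) then (f ((up k r)(i := t)) - f (r(i := t)))\<^sup>2 else 0)"
    using ki by (simp add: sum_box_insert[OF assms(1)] up_def fun_upd_twist cong: if_cong)
  also have "\<dots> = (\<Sum>t\<in>{0..int (s i)}. dir_form (box I s) k (\<lambda>r. f (r(i := t))))"
    unfolding dir_form_def using assms by (subst sum.swap) (simp add: up_in_box_iff cong: sum.cong)
  finally show ?thesis .
qed

lemma sum_int_interval: "(\<Sum>t\<in>{0..int n}. F t) = (\<Sum>i<Suc n. F (int i))"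
  by (rule sum.reindex_bij_witness[where i=int and j=nat]) auto

lemma sum_int_interval_diff:
  "(\<Sum>t\<in>{0..int n}. if t < int n then F t else 0) = (\<Sum>i<n. F (int i) :: real)"
  unfolding sum_int_interval by (simp add: sum.lessThan_Suc)

lemma sum_square_shift:
  fixes g :: "'a \<Rightarrow> real"
  shows "(\<Sum>x\<in>V. (g x - m)\<^sup>2) = (\<Sum>x\<in>V. (g x)\<^sup>2) - 2 * m * (\<Sum>x\<in>V. g x) + real (card V) * m\<^sup>2"
proof -
  have "(g x - m)\<^sup>2 = (g x)\<^sup>2 - 2 * m * g x + m\<^sup>2" for x
    by (simp add: power2_eq_square algebra_simps)
  then show ?thesis by (simp add: sum.distrib sum_subtractf sum_distrib_left)
qed

text \<open>
  Functions of any mean are admitted, with the contribution of the mean on the right; in this form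
  the inequality tensorizes.
\<close>

lemma interval_poincare:
  fixes F :: "int \<Rightarrow> real"
  assumes "n < N"
  shows "(\<Sum>t\<in>{0..int n}. (F t)\<^sup>2) \<le>
    path_const N * (\<Sum>t\<in>{0..int n}. if t < int n then (F (t + 1) - F t)\<^sup>2 else 0)
      + (\<Sum>t\<in>{0..int n}. F t)\<^sup>2 / real (Suc n)"
proof -
  define m where "m = (\<Sum>i<Suc n. F (int i)) / real (Suc n)"
  define f where "f i = F (int i) - m" for i
  have m: "(\<Sum>i<Suc n. F (int i)) = real (Suc n) * m" by (simp add: m_def)
  have "(\<Sum>i<Suc n. f i) = 0" using m by (simp add: f_def sum_subtractf del: sum.lessThan_Suc)
  then have "(\<Sum>i<Suc n. (f i)\<^sup>2) \<le> path_const (Suc n) * (\<Sum>i<n. (f (Suc i) - f i)\<^sup>2)"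
    using path_poincare[of "Suc n" f] by simp
  also have "\<dots> \<le> path_const N * (\<Sum>i<n. (f (Suc i) - f i)\<^sup>2)"
    using assms by (intro mult_right_mono path_const_mono sum_nonneg) auto
  finally have "(\<Sum>i<Suc n. (f i)\<^sup>2) \<le> path_const N * (\<Sum>i<n. (f (Suc i) - f i)\<^sup>2)" .
  moreover have "(\<Sum>i<Suc n. (f i)\<^sup>2) = (\<Sum>i<Suc n. (F (int i))\<^sup>2) - (real (Suc n) * m)\<^sup>2 / real (Suc n)"
  proof -
    show ?thesis
      unfolding f_def sum_square_shift m by (simp add: power2_eq_square field_simps del: sum.lessThan_Suc)
  qed
  ultimately show ?thesis
    unfolding sum_int_interval_diff[of n "\<lambda>t. (F (t + 1) - F t)\<^sup>2"]
    unfolding sum_int_interval m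
    by (simp add: f_def add.commute del: sum.lessThan_Suc)
qed

text \<open>
  Tensorization: fix the new coordinate and apply the induction hypothesis to each slice; the sums
  over the slices form a function \<open>F\<close> on an interval whose energy is bounded by the energy in
  the new direction, by the Cauchy-Schwarz inequality.
\<close>

lemma box_poincare:
  assumes "finite I" "\<And>i. i \<in> I \<Longrightarrow> s i < N" "N > 0"
  shows "(\<Sum>x\<in>box I s. (f x)\<^sup>2) \<le> path_const N * (\<Sum>i\<in>I. dir_form (box I s) i f)
     + (\<Sum>x\<in>box I s. f x)\<^sup>2 / real (card (box I s))"
  using assms(1,2)
proof (induction I arbitrary: f rule: finite_induct)
  case empty
  then show ?case by (simp add: box_def)
next
  case (insert i I)
  let ?T = "{0..int (s i)}" and ?B = "box I s" and ?B' = "box (insert i I) s"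
  define F where "F t = (\<Sum>r\<in>?B. f (r(i := t)))" for t
  have K: "path_const N \<ge> 0" using path_const_pos[OF assms(3)] by simp
  have card: "card ?B' = Suc (s i) * card ?B"
    using sum_box_insert[OF insert.hyps(2), of "\<lambda>_. 1 :: nat" s] by (simp add: nat_add_distrib)
  have B: "card ?B > 0"
    using insert.hyps(1) by (rule card_box_pos)
  have "(\<Sum>x\<in>?B'. (f x)\<^sup>2) = (\<Sum>t\<in>?T. \<Sum>r\<in>?B. (f (r(i := t)))\<^sup>2)"
    by (subst sum.swap) (rule sum_box_insert[OF insert.hyps(2)])
  also have "\<dots> \<le> (\<Sum>t\<in>?T. path_const N * (\<Sum>k\<in>I. dir_form ?B k (\<lambda>r. f (r(i := t)))) + (F t)\<^sup>2 / real (card ?B))"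
    unfolding F_def using insert.prems by (intro sum_mono insert.IH) auto
  also have "\<dots> = path_const N * (\<Sum>k\<in>I. dir_form ?B' k f) + (\<Sum>t\<in>?T. (F t)\<^sup>2) / real (card ?B)"
  proof -
    have "(\<Sum>k\<in>I. dir_form ?B' k f) = (\<Sum>t\<in>?T. \<Sum>k\<in>I. dir_form ?B k (\<lambda>r. f (r(i := t))))"
      by (subst sum.swap) (intro sum.cong refl dir_form_box_old insert.hyps)
    then show ?thesis by (simp add: sum.distrib sum_distrib_left sum_divide_distrib)
  qed
  also have "(\<Sum>t\<in>?T. (F t)\<^sup>2) / real (card ?B) \<le>
      path_const N * dir_form ?B' i f + (\<Sum>x\<in>?B'. f x)\<^sup>2 / real (card ?B')"
  proof -
    have "(F (t + 1) - F t)\<^sup>2 \<le> (\<Sum>r\<in>?B. (f (r(i := t + 1)) - f (r(i := t)))\<^sup>2) * real (card ?B)" for t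
      unfolding F_def sum_subtractf[symmetric] by (rule sum_squared_le_sum_of_squares)
    then have "(\<Sum>t\<in>?T. if t < int (s i) then (F (t + 1) - F t)\<^sup>2 else 0) \<le>
        (\<Sum>t\<in>?T. (\<Sum>r\<in>?B. if t < int (s i) then (f (r(i := t + 1)) - f (r(i := t)))\<^sup>2 else 0) * real (card ?B))"
      by (intro sum_mono) auto
    also have "\<dots> = dir_form ?B' i f * real (card ?B)"
      unfolding dir_form_box_new[OF insert.hyps(2)] sum_distrib_right by (rule sum.swap)
    finally have *: "path_const N * (\<Sum>t\<in>?T. if t < int (s i) then (F (t + 1) - F t)\<^sup>2 else 0)
        \<le> path_const N * (dir_form ?B' i f * real (card ?B))"
      using K by (intro mult_left_mono)
    have S: "(\<Sum>x\<in>?B'. f x) = (\<Sum>t\<in>?T. F t)"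
      unfolding F_def by (subst sum.swap) (rule sum_box_insert[OF insert.hyps(2)])
    have "(\<Sum>t\<in>?T. (F t)\<^sup>2) \<le> path_const N * (dir_form ?B' i f * real (card ?B)) + (\<Sum>t\<in>?T. F t)\<^sup>2 / real (Suc (s i))"
      using interval_poincare[of "s i" N F] insert.prems * by fastforce
    then have "(\<Sum>t\<in>?T. (F t)\<^sup>2) / real (card ?B) \<le>
        (path_const N * (dir_form ?B' i f * real (card ?B)) + (\<Sum>t\<in>?T. F t)\<^sup>2 / real (Suc (s i))) / real (card ?B)"
      by (rule divide_right_mono) simp
    also have "\<dots> = path_const N * dir_form ?B' i f + (\<Sum>t\<in>?T. F t)\<^sup>2 / (real (Suc (s i)) * real (card ?B))"
      using B by (simp add: add_divide_distrib)
    finally show ?thesis by (simp only: S card of_nat_mult)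
  qed
  finally show ?case using insert.hyps by (simp add: algebra_simps)
qed

text \<open>
  A discrete trace inequality: compare the value at the endpoint with every other value and average.
\<close>

lemma interval_endpoint_bound:
  fixes F :: "int \<Rightarrow> real"
  shows "(F (int n))\<^sup>2 \<le> 2 / real (Suc n) * (\<Sum>t\<in>{0..int n}. (F t)\<^sup>2)
     + 2 * real n * (\<Sum>t\<in>{0..int n}. if t < int n then (F (t + 1) - F t)\<^sup>2 else 0)"
proof -
  define f where "f i = F (int i)" for i
  define D where "D = (\<Sum>i<n. (f (Suc i) - f i)\<^sup>2)"
  have "(f n)\<^sup>2 \<le> 2 * (f t)\<^sup>2 + 2 * real n * D" if "t < Suc n" for t
  proof -
    have "f n - f t = (\<Sum>i=t..<n. f (Suc i) - f i)" using that by (subst sum_Suc_diff') auto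
    then have "(f n - f t)\<^sup>2 \<le> (\<Sum>i=t..<n. (f (Suc i) - f i)\<^sup>2) * real (card {t..<n})"
      by (simp only: sum_squared_le_sum_of_squares)
    also have "\<dots> \<le> D * real n"
      unfolding D_def by (intro mult_mono sum_mono2) (auto intro: sum_nonneg)
    finally have "(f n - f t)\<^sup>2 \<le> real n * D" by (simp add: mult.commute)
    moreover have "(f n)\<^sup>2 \<le> 2 * (f t)\<^sup>2 + 2 * (f n - f t)\<^sup>2"
      using zero_le_power2[of "f n - 2 * f t"] by (simp add: power2_eq_square algebra_simps)
    ultimately show ?thesis by linarith
  qed
  then have "(\<Sum>t<Suc n. (f n)\<^sup>2) \<le> (\<Sum>t<Suc n. 2 * (f t)\<^sup>2 + 2 * real n * D)"
    by (intro sum_mono) auto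
  then have "real (Suc n) * (f n)\<^sup>2 \<le> 2 * (\<Sum>t<Suc n. (f t)\<^sup>2) + 2 * real n * (real (Suc n) * D)"
    by (simp only: sum.distrib sum_distrib_left[symmetric] sum_constant card_lessThan)
  then have "(f n)\<^sup>2 \<le> 2 / real (Suc n) * (\<Sum>t<Suc n. (f t)\<^sup>2) + 2 * real n * D"
    by (simp add: field_simps del: sum.lessThan_Suc)
  then show ?thesis
    unfolding sum_int_interval_diff[of n "\<lambda>t. (F (t + 1) - F t)\<^sup>2"]
    unfolding sum_int_interval
    by (simp add: f_def D_def add.commute del: sum.lessThan_Suc)
qed

lemma box_face_bound:
  assumes "finite I" "j \<in> I"
  shows "(\<Sum>x | x \<in> box I s \<and> x j = int (s j). (f x)\<^sup>2) \<le>
     2 / real (Suc (s j)) * (\<Sum>x\<in>box I s. (f x)\<^sup>2) + 2 * real (s j) * dir_form (box I s) j f"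
proof -
  define J where "J = I - {j}"
  have I: "I = insert j J" and j: "j \<notin> J" using assms by (auto simp: J_def)
  have "(\<Sum>x | x \<in> box I s \<and> x j = int (s j). (f x)\<^sup>2)
      = (\<Sum>x\<in>box I s. if x j = int (s j) then (f x)\<^sup>2 else 0)"
    using finite_box[OF assms(1)] by (simp add: sum.inter_filter)
  also have "\<dots> = (\<Sum>r\<in>box J s. (f (r(j := int (s j))))\<^sup>2)"
    unfolding I sum_box_insert[OF j] by (simp cong: if_cong)
  also have "\<dots> \<le> (\<Sum>r\<in>box J s. 2 / real (Suc (s j)) * (\<Sum>t\<in>{0..int (s j)}. (f (r(j := t)))\<^sup>2)
     + 2 * real (s j) * (\<Sum>t\<in>{0..int (s j)}. if t < int (s j) then (f (r(j := t + 1)) - f (r(j := t)))\<^sup>2 else 0))"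
    by (intro sum_mono interval_endpoint_bound)
  also have "\<dots> = 2 / real (Suc (s j)) * (\<Sum>x\<in>box I s. (f x)\<^sup>2) + 2 * real (s j) * dir_form (box I s) j f"
    unfolding I dir_form_box_new[OF j] sum_box_insert[OF j] by (simp only: sum.distrib sum_distrib_left)
  finally show ?thesis .
qed

text \<open>
  The value at a new vertex is controlled by the value at its neighbour on the face and the energy of
  the edge between them, and the values on the face by the trace inequality. With
  \<open>path_const N \<le> N\<^sup>2\<close> and \<open>N \<le> s j + 2\<close> the total cost is linear in \<open>N\<close>. Each new vertex is
  treated on its own through its edge to the face, so the shape of \<open>X\<close> does not matter.
\<close>

lemma box_with_layer_poincare:
  fixes s :: "nat \<Rightarrow> nat" and g :: "(nat \<Rightarrow> int) \<Rightarrow> real"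
  assumes fin: "finite I" and j: "j \<in> I" and s: "\<And>i. i \<in> I \<Longrightarrow> s i < N" and N: "2 \<le> N" "N \<le> s j + 2"
    and X: "X \<subseteq> {x \<in> box I s. x j = int (s j)}"
    and V: "V = box I s \<union> up j ` X"
    and g0: "(\<Sum>x\<in>V. g x) = 0"
  shows "(\<Sum>x\<in>V. (g x)\<^sup>2) \<le> (path_const N + 12 * real N + 2) * (\<Sum>i\<in>I. dir_form V i g)"
proof -
  let ?b = "box I s"
  \<comment> \<open>Centering at the mean over the box, which makes the Poincare inequality of the box applicable,
    can only increase the sum of squares over \<open>V\<close>.\<close>
  define m where "m = (\<Sum>x\<in>?b. g x) / real (card ?b)"
  define f where "f x = g x - m" for x
  define T where "T = (\<Sum>x\<in>X. (f (up j x) - f x)\<^sup>2)"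
  define A where "A = (\<Sum>i\<in>I. dir_form ?b i f)"
  have finb: "finite ?b" using fin by (rule finite_box)
  have cardb: "card ?b > 0"
    using fin by (rule card_box_pos)
  have Xb: "X \<subseteq> ?b" by (rule order_trans[OF X]) simp
  then have finX: "finite X" using finb by (rule finite_subset)
  have out: "up j x \<notin> ?b" if "x \<in> X" for x
  proof -
    have "x \<in> ?b" "x j = int (s j)" using X that by blast+
    then show ?thesis using up_in_box_iff[OF j, of x s] by simp
  qed
  then have disj: "?b \<inter> up j ` X = {}" by blast
  have finV: "finite V" unfolding V using finb finX by simp
  have f0: "(\<Sum>x\<in>?b. f x) = 0" using cardb by (simp add: f_def sum_subtractf m_def)
  have A0: "A \<ge> 0" unfolding A_def by (intro sum_nonneg dir_form_nonneg)
  have T0: "T \<ge> 0" unfolding T_def by (intro sum_nonneg) simp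
  have form: "A + T \<le> (\<Sum>i\<in>I. dir_form V i g)"
  proof -
    have other: "dir_form ?b i f \<le> dir_form V i f" for i
    proof -
      have "dir_form ?b i f \<le> (\<Sum>x\<in>?b. if up i x \<in> V then (f (up i x) - f x)\<^sup>2 else 0)"
        unfolding dir_form_def V by (intro sum_mono) auto
      also have "\<dots> \<le> dir_form V i f"
        unfolding dir_form_def using V finV by (intro sum_mono2) auto
      finally show ?thesis .
    qed
    have "dir_form ?b j f + T \<le> dir_form V j f"
    proof -
      have "T = (\<Sum>x\<in>?b. if x \<in> X then (f (up j x) - f x)\<^sup>2 else 0)"
        unfolding T_def using Xb by (intro sum.mono_neutral_cong_left[OF finb]) simp_all
      then have "dir_form ?b j f + T = (\<Sum>x\<in>?b. (if up j x \<in> ?b then (f (up j x) - f x)\<^sup>2 else 0)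
           + (if x \<in> X then (f (up j x) - f x)\<^sup>2 else 0))"
        by (simp add: dir_form_def sum.distrib)
      also have "\<dots> \<le> (\<Sum>x\<in>?b. if up j x \<in> V then (f (up j x) - f x)\<^sup>2 else 0)"
        using disj by (intro sum_mono) (auto simp: V)
      also have "\<dots> \<le> dir_form V j f"
        unfolding dir_form_def using V finV by (intro sum_mono2) auto
      finally show ?thesis .
    qed
    moreover have "(\<Sum>i\<in>I - {j}. dir_form ?b i f) \<le> (\<Sum>i\<in>I - {j}. dir_form V i f)"
      by (intro sum_mono other)
    ultimately have "A + T \<le> (\<Sum>i\<in>I. dir_form V i f)"
      unfolding A_def sum.remove[OF fin j] by linarith
    moreover have "f = (\<lambda>x. g x - m)" by (simp add: f_def fun_eq_iff)
    ultimately show ?thesis by (simp add: dir_form_shift)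
  qed
  have base: "(\<Sum>x\<in>?b. (f x)\<^sup>2) \<le> path_const N * A"
    using box_poincare[of I s N f, OF fin s] N f0 by (simp add: A_def)
  have face: "(\<Sum>x\<in>X. (f x)\<^sup>2) \<le> 2 / real (Suc (s j)) * (path_const N * A) + 2 * real (s j) * A"
  proof -
    have "(\<Sum>x\<in>X. (f x)\<^sup>2) \<le> (\<Sum>x | x \<in> ?b \<and> x j = int (s j). (f x)\<^sup>2)"
      using X finb by (intro sum_mono2) simp_all
    also have "\<dots> \<le> 2 / real (Suc (s j)) * (\<Sum>x\<in>?b. (f x)\<^sup>2) + 2 * real (s j) * dir_form ?b j f"
      by (rule box_face_bound[OF fin j])
    also have "\<dots> \<le> 2 / real (Suc (s j)) * (path_const N * A) + 2 * real (s j) * A"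
      unfolding A_def using base fin j
      by (intro add_mono mult_left_mono member_le_sum dir_form_nonneg) (auto simp: A_def)
    finally show ?thesis .
  qed
  have "(\<Sum>x\<in>up j ` X. (f x)\<^sup>2) = (\<Sum>x\<in>X. (f (up j x))\<^sup>2)"
    by (subst sum.reindex) (auto intro: inj_on_subset[OF inj_up])
  also have "\<dots> \<le> (\<Sum>x\<in>X. 2 * (f (up j x) - f x)\<^sup>2 + 2 * (f x)\<^sup>2)"
  proof (rule sum_mono)
    fix x show "(f (up j x))\<^sup>2 \<le> 2 * (f (up j x) - f x)\<^sup>2 + 2 * (f x)\<^sup>2"
      using zero_le_power2[of "f (up j x) - 2 * f x"] by (simp add: power2_eq_square algebra_simps)
  qed
  also have "\<dots> = 2 * T + 2 * (\<Sum>x\<in>X. (f x)\<^sup>2)"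
    by (simp add: T_def sum.distrib sum_distrib_left)
  finally have layer: "(\<Sum>x\<in>up j ` X. (f x)\<^sup>2) \<le> 2 * T + 2 * (\<Sum>x\<in>X. (f x)\<^sup>2)" .
  have "(\<Sum>x\<in>V. (g x)\<^sup>2) \<le> (\<Sum>x\<in>V. (f x)\<^sup>2)"
    unfolding f_def sum_square_shift g0 by simp
  also have "\<dots> = (\<Sum>x\<in>?b. (f x)\<^sup>2) + (\<Sum>x\<in>up j ` X. (f x)\<^sup>2)"
    unfolding V using finb finX disj by (intro sum.union_disjoint) auto
  also have "\<dots> \<le> path_const N * A + 2 * T + 4 / real (Suc (s j)) * path_const N * A + 4 * real (s j) * A"
  proof -
    define q where "q = path_const N * A / real (Suc (s j))"
    have "2 / real (Suc (s j)) * (path_const N * A) = 2 * q" "4 / real (Suc (s j)) * path_const N * A = 4 * q"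
      by (simp_all add: q_def)
    then show ?thesis using base layer face by linarith
  qed
  also have "\<dots> \<le> (path_const N + 12 * real N + 2) * (A + T)"
  proof -
    have "4 / real (Suc (s j)) * path_const N \<le> 4 / real (Suc (s j)) * (real N)\<^sup>2"
      using path_const_le[OF N(1)] by (intro mult_left_mono) auto
    also have "\<dots> \<le> 8 * real N"
    proof -
      have "real N * real N \<le> real N * (2 * real (Suc (s j)))"
        using N by (intro mult_left_mono) auto
      then show ?thesis by (simp add: field_simps power2_eq_square)
    qed
    finally have "4 / real (Suc (s j)) * path_const N * A \<le> 8 * real N * A"
      using A0 by (rule mult_right_mono)
    moreover have "4 * real (s j) * A \<le> 4 * real N * A"
      using s[OF j] A0 by (intro mult_right_mono) auto
    moreover have "0 \<le> (path_const N + 12 * real N) * T" "0 \<le> 2 * A"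
      using path_const_pos[of N] N A0 T0 by (auto intro!: mult_nonneg_nonneg add_nonneg_nonneg)
    ultimately show ?thesis by (simp add: algebra_simps)
  qed
  also have "\<dots> \<le> (path_const N + 12 * real N + 2) * (\<Sum>i\<in>I. dir_form V i g)"
    using form path_const_pos[of N] N by (intro mult_left_mono) auto
  finally show ?thesis .
qed

section \<open>From the Poincare inequality to the spectral gap\<close>

text \<open>
  Normalized eigenfunctions for distinct eigenvalues are orthonormal. Summing Bessel's inequality for
  the point masses over \<open>W\<close> bounds their number by the cardinality of \<open>W\<close>.
\<close>

lemma finite_eigenvalues:
  fixes Q :: "'s \<Rightarrow> 's \<Rightarrow> real"
  assumes W: "finite W" and sym: "\<And>x y. x \<in> W \<Longrightarrow> y \<in> W \<Longrightarrow> Q x y = Q y x"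
  shows "finite {\<alpha>. \<exists>f. (\<exists>x\<in>W. f x \<noteq> 0) \<and> (\<forall>x\<in>W. (\<Sum>y\<in>W. Q x y * f y) = - \<alpha> * f x)}"
    (is "finite ?S")
proof (rule ccontr)
  assume "infinite ?S"
  then obtain A where "finite A \<and> card A = Suc (card W) \<and> A \<subseteq> ?S"
    by (rule exE[OF infinite_arbitrarily_large])
  then have A: "A \<subseteq> ?S" "finite A" "card A = Suc (card W)" by blast+
  have "\<exists>f. (\<exists>x\<in>W. f x \<noteq> 0) \<and> (\<forall>x\<in>W. (\<Sum>y\<in>W. Q x y * f y) = - \<alpha> * f x)" if "\<alpha> \<in> A" for \<alpha>
    using A(1) that by auto
  then obtain f where f: "\<And>\<alpha>. \<alpha> \<in> A \<Longrightarrow> \<exists>x\<in>W. f \<alpha> x \<noteq> 0"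
      "\<And>\<alpha> x. \<alpha> \<in> A \<Longrightarrow> x \<in> W \<Longrightarrow> (\<Sum>y\<in>W. Q x y * f \<alpha> y) = - \<alpha> * f \<alpha> x"
    by metis
  have f_pos: "(\<Sum>x\<in>W. (f \<alpha> x)\<^sup>2) > 0" if "\<alpha> \<in> A" for \<alpha>
    using f(1)[OF that] W by (meson sum_pos2 zero_le_power2 zero_less_power2)
  define g where "g \<alpha> x = f \<alpha> x / sqrt (\<Sum>x\<in>W. (f \<alpha> x)\<^sup>2)" for \<alpha> x
  have norm: "(\<Sum>x\<in>W. g \<alpha> x * g \<alpha> x) = 1" if "\<alpha> \<in> A" for \<alpha>
    using f_pos[OF that] by (simp add: g_def power2_eq_square[symmetric] power_divide sum_divide_distrib[symmetric])
  have orth: "(\<Sum>x\<in>W. g \<alpha> x * g \<beta> x) = 0" if "\<alpha> \<in> A" "\<beta> \<in> A" "\<alpha> \<noteq> \<beta>" for \<alpha> \<beta>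
  proof -
    have "\<alpha> * (\<Sum>x\<in>W. f \<alpha> x * f \<beta> x) = - (\<Sum>x\<in>W. (\<Sum>y\<in>W. Q x y * f \<alpha> y) * f \<beta> x)"
      using f(2)[OF that(1)] by (simp add: sum_distrib_left sum_negf mult.assoc)
    also have "\<dots> = - (\<Sum>y\<in>W. (\<Sum>x\<in>W. Q y x * f \<beta> x) * f \<alpha> y)"
      unfolding sum_distrib_right by (subst sum.swap) (simp add: sym mult_ac cong: sum.cong)
    also have "\<dots> = \<beta> * (\<Sum>x\<in>W. f \<alpha> x * f \<beta> x)"
      using f(2)[OF that(2)] by (simp add: sum_distrib_left sum_negf mult_ac)
    finally have "(\<Sum>x\<in>W. f \<alpha> x * f \<beta> x) = 0" using that(3) by simp
    then show ?thesis by (simp add: g_def sum_divide_distrib[symmetric])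
  qed
  have bessel: "(\<Sum>\<alpha>\<in>A. (g \<alpha> x)\<^sup>2) \<le> 1" if x: "x \<in> W" for x
  proof -
    let ?c = "\<Sum>\<alpha>\<in>A. (g \<alpha> x)\<^sup>2"
    let ?p = "\<lambda>y. \<Sum>\<alpha>\<in>A. g \<alpha> x * g \<alpha> y"
    have "(\<Sum>y\<in>W. ?p y * ?p y) =
        (\<Sum>y\<in>W. \<Sum>\<alpha>\<in>A. \<Sum>\<beta>\<in>A. g \<alpha> x * g \<beta> x * (g \<alpha> y * g \<beta> y))"
      unfolding sum_product by (intro sum.cong refl) simp
    also have "\<dots> = (\<Sum>\<alpha>\<in>A. \<Sum>\<beta>\<in>A. g \<alpha> x * g \<beta> x * (\<Sum>y\<in>W. g \<alpha> y * g \<beta> y))"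
      by (simp only: sum.swap[of _ A W] sum_distrib_left)
    also have "\<dots> = (\<Sum>\<alpha>\<in>A. \<Sum>\<beta>\<in>A. if \<beta> = \<alpha> then (g \<alpha> x)\<^sup>2 else 0)"
      by (intro sum.cong refl) (auto simp: norm orth power2_eq_square)
    also have "\<dots> = ?c" using A(2) by simp
    finally have pp: "(\<Sum>y\<in>W. ?p y * ?p y) = ?c" .
    have "0 \<le> (\<Sum>y\<in>W. (of_bool (y = x) - ?p y)\<^sup>2)" by (intro sum_nonneg) simp
    also have "\<dots> = (\<Sum>y\<in>W. if y = x then 1 - 2 * ?p x else 0) + (\<Sum>y\<in>W. ?p y * ?p y)"
      unfolding sum.distrib[symmetric] by (intro sum.cong refl) (auto simp: power2_eq_square algebra_simps)
    also have "\<dots> = 1 - 2 * ?p x + ?c" unfolding pp using x W by simp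
    also have "?p x = ?c" by (simp add: power2_eq_square)
    finally show ?thesis by simp
  qed
  have "real (card A) = (\<Sum>\<alpha>\<in>A. \<Sum>x\<in>W. (g \<alpha> x)\<^sup>2)" using norm by (simp add: power2_eq_square)
  also have "\<dots> = (\<Sum>x\<in>W. \<Sum>\<alpha>\<in>A. (g \<alpha> x)\<^sup>2)" by (rule sum.swap)
  also have "\<dots> \<le> (\<Sum>x\<in>W. 1)" using bessel by (intro sum_mono) auto
  finally show False using A(3) by simp
qed

definition edge_weight :: "'v set set \<Rightarrow> 'v \<Rightarrow> 'v \<Rightarrow> real" where
  "edge_weight E x y = of_bool ({x, y} \<in> E)"

lemma edge_weight_sym: "edge_weight E x y = edge_weight E y x"
  by (simp add: edge_weight_def insert_commute)

text \<open>
  The value of \<open>transpose x y\<close> depends only on the set \<open>{x, y}\<close>, and every edge is the set of exactly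
  two ordered pairs of vertices.
\<close>

lemma ip_rate_eq_sum:
  assumes V: "finite V" and E: "\<And>e. e \<in> E \<Longrightarrow> \<exists>a\<in>V. \<exists>b\<in>V. a \<noteq> b \<and> e = {a, b}"
  shows "ip_rate E \<pi> \<sigma> =
    (\<Sum>x\<in>V. \<Sum>y\<in>V. edge_weight E x y * of_bool (\<sigma> = transpose x y \<circ> \<pi>)) / 2"
proof -
  define P where "P e \<longleftrightarrow> (\<exists>i j. e = {i, j} \<and> \<sigma> = transpose i j \<circ> \<pi>)" for e
  have P: "P {x, y} \<longleftrightarrow> \<sigma> = transpose x y \<circ> \<pi>" for x y
    unfolding P_def by (auto simp: doubleton_eq_iff transpose_commute)
  have "E \<subseteq> Pow V" using E by fastforce
  then have finE: "finite E" using V by (simp add: finite_subset)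
  have two: "(\<Sum>x\<in>V. \<Sum>y\<in>V. of_bool (e = {x, y}) :: real) = 2" if "e \<in> E" for e
  proof -
    have "\<exists>a\<in>V. \<exists>b\<in>V. a \<noteq> b \<and> e = {a, b}" using that by (rule E)
    then obtain a b where ab: "a \<in> V" "b \<in> V" "a \<noteq> b" "e = {a, b}" by blast
    have "(\<Sum>x\<in>V. \<Sum>y\<in>V. of_bool (e = {x, y}) :: real) =
        (\<Sum>x\<in>V. \<Sum>y\<in>V. (if x = a then if y = b then 1 else 0 else 0) + (if x = b then if y = a then 1 else 0 else 0))"
      using ab by (intro sum.cong refl) (auto simp: doubleton_eq_iff)
    also have "\<dots> = (\<Sum>x\<in>V. (if x = a then 1 else 0) + (if x = b then 1 else 0))"
      using ab V by (intro sum.cong refl) (auto simp: sum.distrib)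
    also have "\<dots> = 2" using ab V by (simp add: sum.distrib)
    finally show ?thesis .
  qed
  have "(\<Sum>x\<in>V. \<Sum>y\<in>V. edge_weight E x y * of_bool (\<sigma> = transpose x y \<circ> \<pi>)) =
      (\<Sum>x\<in>V. \<Sum>y\<in>V. \<Sum>e\<in>E. of_bool (e = {x, y}) * of_bool (P e))"
  proof (intro sum.cong refl)
    fix x y
    have "(\<Sum>e\<in>E. of_bool (e = {x, y}) * of_bool (P e) :: real) = (\<Sum>e\<in>E. if e = {x, y} then of_bool (P {x, y}) else 0)"
      by (intro sum.cong refl) auto
    also have "\<dots> = edge_weight E x y * of_bool (\<sigma> = transpose x y \<circ> \<pi>)"
      using finE by (simp add: edge_weight_def P)
    finally show "edge_weight E x y * of_bool (\<sigma> = transpose x y \<circ> \<pi>) = (\<Sum>e\<in>E. of_bool (e = {x, y}) * of_bool (P e))"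
      by simp
  qed
  also have "\<dots> = (\<Sum>e\<in>E. (\<Sum>x\<in>V. \<Sum>y\<in>V. of_bool (e = {x, y})) * of_bool (P e))"
    by (simp add: sum.swap[of _ E V] sum_distrib_right)
  also have "\<dots> = 2 * (\<Sum>e\<in>E. of_bool (P e))" by (simp add: two sum_distrib_left)
  also have "(\<Sum>e\<in>E. of_bool (P e) :: real) = ip_rate E \<pi> \<sigma>"
    unfolding ip_rate_def P_def[symmetric] using finE by (simp add: Int_def)
  finally show ?thesis by linarith
qed

lemma ip_rate_matrix_eq_gen:
  assumes V: "finite V" and E: "\<And>e. e \<in> E \<Longrightarrow> \<exists>a\<in>V. \<exists>b\<in>V. a \<noteq> b \<and> e = {a, b}"
    and \<pi>: "\<pi> \<in> ip_configs V"
  shows "(\<Sum>\<sigma>\<in>ip_configs V. rate_matrix (ip_configs V) (ip_rate E) \<pi> \<sigma> * f \<sigma>) = - ip_gen V (edge_weight E) f \<pi>"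
proof -
  let ?W = "ip_configs V"
  have W: "finite ?W" using V by (simp add: ip_configs_def finite_permutations)
  have "(\<Sum>\<sigma>\<in>?W. rate_matrix ?W (ip_rate E) \<pi> \<sigma> * f \<sigma>)
      = (\<Sum>\<sigma>\<in>?W - {\<pi>}. ip_rate E \<pi> \<sigma> * (f \<sigma> - f \<pi>))"
  proof -
    have "(\<Sum>\<sigma>\<in>?W - {\<pi>}. rate_matrix ?W (ip_rate E) \<pi> \<sigma> * f \<sigma>) = (\<Sum>\<sigma>\<in>?W - {\<pi>}. ip_rate E \<pi> \<sigma> * f \<sigma>)"
      by (intro sum.cong refl) (auto simp: rate_matrix_def)
    moreover have "rate_matrix ?W (ip_rate E) \<pi> \<pi> * f \<pi> = - (\<Sum>\<sigma>\<in>?W - {\<pi>}. ip_rate E \<pi> \<sigma> * f \<pi>)"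
      by (simp add: rate_matrix_def sum_distrib_right)
    ultimately show ?thesis
      unfolding sum.remove[OF W \<pi>] by (simp add: sum_subtractf right_diff_distrib)
  qed
  also have "\<dots> = (\<Sum>\<sigma>\<in>?W. ip_rate E \<pi> \<sigma> * (f \<sigma> - f \<pi>))"
    by (simp add: sum.remove[OF W \<pi>])
  also have "\<dots> = (\<Sum>\<sigma>\<in>?W. \<Sum>x\<in>V. \<Sum>y\<in>V. edge_weight E x y * (of_bool (\<sigma> = transpose x y \<circ> \<pi>) * (f \<sigma> - f \<pi>))) / 2"
    by (simp add: ip_rate_eq_sum[OF V E] sum_distrib_right sum_divide_distrib mult.assoc)
  also have "\<dots> = (\<Sum>x\<in>V. \<Sum>y\<in>V. edge_weight E x y * (\<Sum>\<sigma>\<in>?W. of_bool (\<sigma> = transpose x y \<circ> \<pi>) * (f \<sigma> - f \<pi>))) / 2"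
    by (simp add: sum.swap[of _ V ?W] sum_distrib_left)
  also have "\<dots> = (\<Sum>x\<in>V. \<Sum>y\<in>V. edge_weight E x y * (f (transpose x y \<circ> \<pi>) - f \<pi>)) / 2"
  proof -
    have "(\<Sum>\<sigma>\<in>?W. of_bool (\<sigma> = transpose x y \<circ> \<pi>) * (f \<sigma> - f \<pi>)) = f (transpose x y \<circ> \<pi>) - f \<pi>"
      if "x \<in> V" "y \<in> V" for x y
    proof -
      have "transpose x y \<circ> \<pi> \<in> ?W"
        using \<pi> that by (auto simp: ip_configs_def intro: permutes_compose permutes_swap_id)
      moreover have "(\<Sum>\<sigma>\<in>?W. of_bool (\<sigma> = transpose x y \<circ> \<pi>) * (f \<sigma> - f \<pi>))
          = (\<Sum>\<sigma>\<in>?W. if \<sigma> = transpose x y \<circ> \<pi> then f (transpose x y \<circ> \<pi>) - f \<pi> else 0)"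
        by (intro sum.cong refl) auto
      ultimately show ?thesis using W by simp
    qed
    then show ?thesis by (simp cong: sum.cong)
  qed
  also have "\<dots> = - ip_gen V (edge_weight E) f \<pi>"
    unfolding ip_gen_def minus_divide_left sum_negf[symmetric]
    by (simp add: algebra_simps)
  finally show ?thesis .
qed

lemma ip_rate_sym: "ip_rate E \<pi> \<sigma> = ip_rate E \<sigma> \<pi>"
proof -
  have "\<sigma> = transpose i j \<circ> \<pi> \<longleftrightarrow> \<pi> = transpose i j \<circ> \<sigma>" for i j
    by (metis comp_assoc comp_id id_comp transpose_comp_involutory)
  then show ?thesis by (simp add: ip_rate_def)
qed

text \<open>
  As there are only finitely many eigenvalues, the least positive one exists as soon as
  there is one, and it is provided by lifting the eigenfunction \<open>g\<close> of the random walk to the position of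
  particle \<open>p\<close>. An eigenfunction for a positive eigenvalue has mean zero, so the Poincare
  inequality applies to it.
\<close>

lemma ip_gap_bounds:
  assumes V: "finite V" and E: "\<And>e. e \<in> E \<Longrightarrow> \<exists>a\<in>V. \<exists>b\<in>V. a \<noteq> b \<and> e = {a, b}"
    and ip: "ip_poincare V (edge_weight E) K" and K: "K > 0"
    and \<mu>: "\<mu> > 0" and p: "p \<in> V" "g p \<noteq> 0"
    and g: "\<And>x. x \<in> V \<Longrightarrow> laplacian V (edge_weight E) g x = \<mu> * g x"
  shows "1 / K \<le> ip_gap V E \<and> ip_gap V E \<le> \<mu>"
proof -
  let ?W = "ip_configs V" and ?Q = "rate_matrix (ip_configs V) (ip_rate E)"
  let ?w = "edge_weight E"
  let ?S = "{\<alpha>. \<alpha> > 0 \<and> (\<exists>f. (\<exists>x\<in>?W. f x \<noteq> 0) \<and> (\<forall>x\<in>?W. (\<Sum>y\<in>?W. ?Q x y * f y) = - \<alpha> * f x))}"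
  have W: "finite ?W" using V by (simp add: ip_configs_def finite_permutations)
  have sym: "?Q x y = ?Q y x" for x y by (auto simp: rate_matrix_def ip_rate_sym)
  have fin: "finite ?S"
    by (rule finite_subset[OF _ finite_eigenvalues[OF W sym]]) auto
  have mem: "\<mu> \<in> ?S"
  proof -
    have "(\<Sum>\<sigma>\<in>?W. ?Q \<pi> \<sigma> * g (\<sigma> p)) = - \<mu> * g (\<pi> p)" if "\<pi> \<in> ?W" for \<pi>
    proof -
      have *: "\<pi> p \<in> V" using that p by (simp add: ip_configs_def permutes_in_image)
      show ?thesis
        using ip_rate_matrix_eq_gen[of V E \<pi>, OF V E that, where f="\<lambda>\<sigma>. g (\<sigma> p)"] ip_gen_single[of V ?w \<pi> p g, OF V edge_weight_sym *] g[OF *]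
        by simp
    qed
    moreover have "id \<in> ?W" "g (id p) \<noteq> 0" using p by (auto simp: ip_configs_def permutes_id)
    ultimately show ?thesis
      using \<mu> by (intro CollectI conjI exI[of _ "\<lambda>\<sigma>. g (\<sigma> p)"] bexI[of _ id] ballI)
  qed
  have gap: "ip_gap V E = Min ?S"
    unfolding ip_gap_def spectral_gap_def using fin mem by (intro Least_Min) auto
  have low: "1 / K \<le> \<alpha>" if \<alpha>: "\<alpha> \<in> ?S" for \<alpha>
  proof -
    obtain f where f: "\<exists>x\<in>?W. f x \<noteq> 0" "\<And>\<pi>. \<pi> \<in> ?W \<Longrightarrow> (\<Sum>\<sigma>\<in>?W. ?Q \<pi> \<sigma> * f \<sigma>) = - \<alpha> * f \<pi>"
      using \<alpha> by (elim CollectE conjE exE) blast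
    have gen: "ip_gen V ?w f \<pi> = \<alpha> * f \<pi>" if "\<pi> \<in> ?W" for \<pi>
      using ip_rate_matrix_eq_gen[of V E \<pi>, OF V E that, where f=f] f(2)[OF that] by simp
    have form: "ip_form V ?w f h = \<alpha> * (\<Sum>\<pi>\<in>?W. f \<pi> * h \<pi>)" for h
      unfolding ip_form_eq_gen[OF V] using gen by (simp add: ip_configs_def sum_distrib_left mult.assoc)
    \<comment> \<open>Pairing the eigenfunction with the constant function shows that its mean is zero.\<close>
    have "ip_form V ?w f (\<lambda>_. 1) = 0" by (simp add: ip_form_def)
    then have "(\<Sum>\<pi>\<in>?W. f \<pi>) = 0" using form[of "\<lambda>_. 1"] \<alpha> by simp
    then have "(\<Sum>\<pi>\<in>?W. (f \<pi>)\<^sup>2) \<le> K * (\<alpha> * (\<Sum>\<pi>\<in>?W. (f \<pi>)\<^sup>2))"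
      using ip[unfolded ip_poincare_def, rule_format, of f] form[of f]
      by (simp add: ip_configs_def power2_eq_square)
    moreover have "(\<Sum>\<pi>\<in>?W. (f \<pi>)\<^sup>2) > 0"
      using f(1) W by (meson sum_pos2 zero_le_power2 zero_less_power2)
    ultimately have "1 \<le> K * \<alpha>" by (simp add: mult.assoc[symmetric])
    then show ?thesis using K by (simp add: field_simps)
  qed
  have "Min ?S \<in> ?S" using fin mem by (intro Min_in) auto
  then have "1 / K \<le> Min ?S" by (rule low)
  moreover have "Min ?S \<le> \<mu>" using fin mem by (rule Min_le)
  ultimately show ?thesis unfolding gap ..
qed

section \<open>Growing a box vertex by vertex\<close>

lemma box_vertices_eq_box: "box_vertices d L = box {..<d} (\<lambda>_. L)"
  by (simp add: box_vertices_def box_def)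

lemma up_neq: "up i x \<noteq> x"
  by (auto simp: up_def dest: fun_cong[where x=i])

lemma up_eq_up_iff: "up i x = up k x \<longleftrightarrow> i = k"
  by (auto simp: up_def fun_eq_iff split: if_splits)

lemma up_up_neq: "up i (up k x) \<noteq> x"
proof
  assume "up i (up k x) = x"
  from fun_cong[OF this, of k] show False by (auto simp: up_def split: if_splits)
qed

lemma nearest_neighbours_iff_up:
  assumes x: "x \<in> box_vertices d L" and y: "y \<in> box_vertices d L"
  shows "nearest_neighbours d x y \<longleftrightarrow> (\<exists>i<d. y = up i x \<or> x = up i y)"
proof
  assume "nearest_neighbours d x y"
  then obtain k where k: "k < d" "\<bar>x k - y k\<bar> = 1" "\<And>l. l < d \<Longrightarrow> l \<noteq> k \<Longrightarrow> x l = y l"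
    by (auto simp: nearest_neighbours_def)
  have eq: "x l = y l" if "l \<noteq> k" for l
    using k(3)[OF _ that] x y by (cases "l < d") (auto simp: box_vertices_def PiE_def extensional_def)
  from k(2) consider "y k = x k + 1" | "x k = y k + 1" by linarith
  then have "y = up k x \<or> x = up k y"
    by cases (use eq in \<open>auto simp: up_def fun_eq_iff\<close>)
  then show "\<exists>i<d. y = up i x \<or> x = up i y" using k(1) by blast
next
  assume "\<exists>i<d. y = up i x \<or> x = up i y"
  then show "nearest_neighbours d x y" by (auto simp: nearest_neighbours_def up_def)
qed

lemma edge_weight_box:
  assumes x: "x \<in> box_vertices d L" and y: "y \<in> box_vertices d L"
  shows "edge_weight (box_edges d L) x y = (\<Sum>i<d. of_bool (y = up i x) + of_bool (x = up i y))"
proof -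
  have "{x, y} \<in> box_edges d L \<longleftrightarrow> nearest_neighbours d x y \<or> nearest_neighbours d y x"
    using x y by (auto simp: box_edges_def doubleton_eq_iff)
  then have E: "{x, y} \<in> box_edges d L \<longleftrightarrow> (\<exists>i<d. y = up i x \<or> x = up i y)"
    using nearest_neighbours_iff_up[OF x y] nearest_neighbours_iff_up[OF y x] by blast
  show ?thesis
  proof (cases "\<exists>i<d. y = up i x \<or> x = up i y")
    case True
    then obtain k where k: "k < d" "y = up k x \<or> x = up k y" by blast
    have "of_bool (y = up i x) + of_bool (x = up i y) = (if i = k then 1 else 0 :: real)" for i
      using k(2) up_up_neq[of i k] up_neq by (auto simp: up_eq_up_iff dest: sym)
    then show ?thesis using True E k(1) by (simp add: edge_weight_def)
  next
    case False
    then show ?thesis using E by (auto simp: edge_weight_def)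
  qed
qed

lemma finite_box_vertices: "finite (box_vertices d L)"
  by (simp add: box_vertices_eq_box finite_box)

lemma rw_form_box:
  assumes V: "V \<subseteq> box_vertices d L"
  shows "rw_form V (edge_weight (box_edges d L)) f = (\<Sum>i<d. dir_form V i f)"
proof -
  have fin: "finite V" using V finite_box_vertices by (rule finite_subset)
  have up: "(\<Sum>x\<in>V. \<Sum>y\<in>V. of_bool (y = up i x) * (f x - f y)\<^sup>2) = dir_form V i f" for i
  proof -
    have "(\<Sum>y\<in>V. of_bool (y = up i x) * (f x - f y)\<^sup>2) = (if up i x \<in> V then (f (up i x) - f x)\<^sup>2 else 0)" for x
    proof -
      have "(\<Sum>y\<in>V. of_bool (y = up i x) * (f x - f y)\<^sup>2) = (\<Sum>y\<in>V. if y = up i x then (f (up i x) - f x)\<^sup>2 else 0)"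
        by (intro sum.cong refl) (auto simp: power2_commute)
      then show ?thesis using fin by simp
    qed
    then show ?thesis by (simp add: dir_form_def)
  qed
  have down: "(\<Sum>x\<in>V. \<Sum>y\<in>V. of_bool (x = up i y) * (f x - f y)\<^sup>2) = dir_form V i f" for i
    by (subst sum.swap) (simp add: up[symmetric] power2_commute)
  have "(\<Sum>x\<in>V. \<Sum>y\<in>V. edge_weight (box_edges d L) x y * (f x - f y)\<^sup>2)
      = (\<Sum>x\<in>V. \<Sum>y\<in>V. \<Sum>i<d. of_bool (y = up i x) * (f x - f y)\<^sup>2 + of_bool (x = up i y) * (f x - f y)\<^sup>2)"
    using V by (intro sum.cong refl) (auto simp: edge_weight_box subsetD sum_distrib_right distrib_right)
  also have "\<dots> = (\<Sum>i<d. \<Sum>x\<in>V. \<Sum>y\<in>V. of_bool (y = up i x) * (f x - f y)\<^sup>2 + of_bool (x = up i y) * (f x - f y)\<^sup>2)"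
    by (simp only: sum.swap[of _ "{..<d}" V])
  also have "\<dots> = 2 * (\<Sum>i<d. dir_form V i f)"
    unfolding sum.distrib up down by simp
  finally show ?thesis by (simp add: rw_form_def)
qed

lemma box_edges_doubleton:
  assumes "e \<in> box_edges d L"
  shows "\<exists>a\<in>box_vertices d L. \<exists>b\<in>box_vertices d L. a \<noteq> b \<and> e = {a, b}"
proof -
  obtain x y where "e = {x, y}" "x \<in> box_vertices d L" "y \<in> box_vertices d L" "nearest_neighbours d x y"
    using assms by (auto simp: box_edges_def)
  moreover from this(4) have "x \<noteq> y" by (auto simp: nearest_neighbours_def)
  ultimately show ?thesis by blast
qed

text \<open>
  The constant from adding part of a layer to a box with side \<open>N - 2\<close> in the direction of the layer,
  for \<open>N = L + 2\<close>; it dominates the constants for all smaller boxes.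
\<close>

definition box_const :: "nat \<Rightarrow> real" where
  "box_const L = path_const (L + 2) + 12 * real (L + 2) + 2"

lemma box_const_pos: "box_const L > 0"
  using path_const_pos[of "L + 2"] by (simp add: box_const_def)

lemma box_add_layer:
  assumes j: "j \<in> I"
  shows "box I (s(j := Suc (s j))) = box I s \<union> up j ` {x \<in> box I s. x j = int (s j)}"
proof (intro equalityI subsetI)
  fix x assume x: "x \<in> box I (s(j := Suc (s j)))"
  then have xj: "0 \<le> x j" "x j \<le> int (Suc (s j))" using j by (auto simp: box_def PiE_iff)
  show "x \<in> box I s \<union> up j ` {x \<in> box I s. x j = int (s j)}"
  proof (cases "x j \<le> int (s j)")
    case True
    then have "x \<in> box I s" using x xj by (auto simp: box_def PiE_iff split: if_splits)
    then show ?thesis ..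
  next
    case False
    let ?y = "x(j := int (s j))"
    have "?y \<in> box I s" using x j by (auto simp: box_def PiE_iff extensional_def split: if_splits)
    moreover have "x = up j ?y" using False xj by (auto simp: up_def fun_eq_iff)
    ultimately show ?thesis by (intro UnI2 image_eqI[of _ _ ?y]) auto
  qed
next
  fix x assume "x \<in> box I s \<union> up j ` {x \<in> box I s. x j = int (s j)}"
  then show "x \<in> box I (s(j := Suc (s j)))"
    using j by (fastforce simp: box_def PiE_iff up_def extensional_def)
qed

lemma ip_poincare_add_layer:
  assumes j: "j < d" and s: "\<And>i. i < d \<Longrightarrow> s i \<le> L" "s j < L" "\<And>i. i < d \<Longrightarrow> s i \<le> Suc (s j)"
    and ip: "ip_poincare (box {..<d} s) (edge_weight (box_edges d L)) (box_const L)"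
  shows "ip_poincare (box {..<d} (s(j := Suc (s j)))) (edge_weight (box_edges d L)) (box_const L)"
proof -
  let ?I = "{..<d}" and ?w = "edge_weight (box_edges d L)"
  let ?b = "box ?I s" and ?face = "{x \<in> box ?I s. x j = int (s j)}"
  have j': "j \<in> ?I" using j by simp
  have fin: "finite ?b" by (simp add: finite_box)
  have sub: "box ?I (s(j := Suc (s j))) \<subseteq> box_vertices d L"
    unfolding box_vertices_eq_box box_def using s by (intro PiE_mono) (auto simp: Suc_le_eq)
  have "ip_poincare (?b \<union> up j ` ?face) ?w (box_const L)"
  proof (rule ip_poincare_chain)
    show "?b \<noteq> {}" using card_box_pos[of ?I s] by force
    show "?b \<inter> up j ` ?face = {}" using up_in_box_iff[OF j'] by fastforce
    fix S assume "S \<subseteq> up j ` ?face"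
    then obtain X where X: "X \<subseteq> ?face" "S = up j ` X" by (meson subset_imageE)
    let ?V = "?b \<union> S" and ?N = "s j + 2"
    have V: "?V \<subseteq> box_vertices d L"
      using sub X unfolding box_add_layer[OF j'] by blast
    show "rw_poincare ?V ?w (box_const L)"
      unfolding rw_poincare_def rw_form_box[OF V]
    proof (intro allI impI)
      fix g :: "(nat \<Rightarrow> int) \<Rightarrow> real"
      assume "(\<Sum>x\<in>?V. g x) = 0"
      then have "(\<Sum>x\<in>?V. (g x)\<^sup>2) \<le> (path_const ?N + 12 * real ?N + 2) * (\<Sum>i<d. dir_form ?V i g)"
        using s X j' by (intro box_with_layer_poincare[where j=j and X=X and s=s]) (auto simp: le_imp_less_Suc)
      also have "\<dots> \<le> box_const L * (\<Sum>i<d. dir_form ?V i g)"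
        unfolding box_const_def using s(2)
        by (intro mult_right_mono add_mono path_const_mono sum_nonneg dir_form_nonneg) auto
      finally show "(\<Sum>x\<in>?V. (g x)\<^sup>2) \<le> box_const L * (\<Sum>i<d. dir_form ?V i g)" .
    qed
  qed (use fin ip box_const_pos[of L] edge_weight_sym in \<open>auto simp: edge_weight_def insert_commute\<close>)
  then show ?thesis by (simp add: box_add_layer[OF j'])
qed

text \<open>
  Pass from the cube of side length \<open>k\<close> to that of side length \<open>k + 1\<close> by adding one layer in each
  direction in turn, so that the side lengths never differ by more than one.
\<close>

lemma ip_poincare_cube:
  "k \<le> L \<Longrightarrow> ip_poincare (box {..<d} (\<lambda>_. k)) (edge_weight (box_edges d L)) (box_const L)"
proof (induction k)
  case 0
  have "box {..<d} (\<lambda>_. 0) = {\<lambda>i. if i < d then 0 else undefined}"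
    by (auto simp: box_def PiE_iff extensional_def fun_eq_iff)
  then show ?case by (simp add: ip_poincare_singleton)
next
  case (Suc k)
  define s where "s m i = (if i < m then Suc k else k)" for m i :: nat
  have "ip_poincare (box {..<d} (s m)) (edge_weight (box_edges d L)) (box_const L)" if "m \<le> d" for m
    using that
  proof (induction m)
    case 0
    then show ?case using Suc by (simp add: s_def)
  next
    case (Suc m)
    have "s (Suc m) = (s m)(m := Suc (s m m))" by (auto simp: s_def fun_eq_iff)
    moreover have "s m i \<le> L" "s m m < L" "s m i \<le> Suc (s m m)" for i
      using \<open>Suc k \<le> L\<close> by (auto simp: s_def)
    ultimately show ?case
      using ip_poincare_add_layer[of m d "s m" L] Suc by (simp del: fun_upd_apply)
  qed
  then have "ip_poincare (box {..<d} (s d)) (edge_weight (box_edges d L)) (box_const L)" by blast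
  moreover have "box {..<d} (s d) = box {..<d} (\<lambda>_. Suc k)"
    unfolding box_def by (intro PiE_cong) (simp add: s_def)
  ultimately show ?case by simp
qed

section \<open>The cosine eigenfunction and the limit\<close>

lemma laplacian_box:
  assumes x: "x \<in> box_vertices d L"
  shows "laplacian (box_vertices d L) (edge_weight (box_edges d L)) g x =
    (\<Sum>i<d. (if x i < int L then g x - g (x(i := x i + 1)) else 0)
          + (if 0 < x i then g x - g (x(i := x i - 1)) else 0))"
proof -
  let ?V = "box_vertices d L"
  have fin: "finite ?V" by (rule finite_box_vertices)
  have up: "(\<Sum>y\<in>?V. of_bool (y = up i x) * (g x - g y)) = (if x i < int L then g x - g (x(i := x i + 1)) else 0)"
    if "i < d" for i
  proof -
    have "(\<Sum>y\<in>?V. of_bool (y = up i x) * (g x - g y)) = (\<Sum>y\<in>?V. if y = up i x then g x - g (up i x) else 0)"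
      by (intro sum.cong refl) auto
    moreover have "up i x \<in> ?V \<longleftrightarrow> x i < int L"
      using up_in_box_iff[of i "{..<d}" x "\<lambda>_. L"] x that by (simp add: box_vertices_eq_box)
    ultimately have "(\<Sum>y\<in>?V. of_bool (y = up i x) * (g x - g y)) = (if x i < int L then g x - g (up i x) else 0)"
      using fin by simp
    then show ?thesis by (simp only: up_def)
  qed
  have down: "(\<Sum>y\<in>?V. of_bool (x = up i y) * (g x - g y)) = (if 0 < x i then g x - g (x(i := x i - 1)) else 0)"
    if "i < d" for i
  proof -
    let ?z = "x(i := x i - 1)"
    have "x = up i y \<longleftrightarrow> y = ?z" for y by (auto simp: up_def fun_eq_iff)
    then have "(\<Sum>y\<in>?V. of_bool (x = up i y) * (g x - g y)) = (\<Sum>y\<in>?V. if y = ?z then g x - g ?z else 0)"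
      by (intro sum.cong refl) auto
    moreover have "?z \<in> ?V \<longleftrightarrow> 0 < x i"
    proof -
      have xi: "0 \<le> x i" "x i \<le> int L" using x that by (auto simp: box_vertices_def PiE_iff)
      show ?thesis
        using x that by (auto simp: box_vertices_def PiE_iff extensional_def split: if_splits) (use xi in linarith)
    qed
    ultimately show ?thesis using fin by simp
  qed
  have "laplacian ?V (edge_weight (box_edges d L)) g x =
      (\<Sum>y\<in>?V. \<Sum>i<d. of_bool (y = up i x) * (g x - g y) + of_bool (x = up i y) * (g x - g y))"
    unfolding laplacian_def using x
    by (intro sum.cong refl) (simp add: edge_weight_box sum_distrib_right distrib_right)
  also have "\<dots> = (\<Sum>i<d. \<Sum>y\<in>?V. of_bool (y = up i x) * (g x - g y) + of_bool (x = up i y) * (g x - g y))"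
    by (rule sum.swap)
  also have "\<dots> = (\<Sum>i<d. (if x i < int L then g x - g (x(i := x i + 1)) else 0)
          + (if 0 < x i then g x - g (x(i := x i - 1)) else 0))"
    by (intro sum.cong refl) (simp add: sum.distrib up down)
  finally show ?thesis .
qed

text \<open>
  The cosine is symmetric about \<open>-1/2\<close> and \<open>L + 1/2\<close>. It therefore takes equal values at \<open>-1\<close> and \<open>0\<close>
  and at \<open>L\<close> and \<open>L + 1\<close>, and the missing edges at the boundary make no difference to the Laplacian.
\<close>

lemma laplacian_box_cosine:
  fixes L :: nat
  assumes d: "d \<ge> 1" and x: "x \<in> box_vertices d L"
  defines "\<theta> \<equiv> pi / real (L + 1)"
  defines "g \<equiv> \<lambda>x :: nat \<Rightarrow> int. cos (\<theta> * (real_of_int (x 0) + 1 / 2))"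
  shows "laplacian (box_vertices d L) (edge_weight (box_edges d L)) g x = (2 - 2 * cos \<theta>) * g x"
proof -
  define c where "c t = cos (\<theta> * (real_of_int t + 1 / 2))" for t :: int
  have g: "g y = c (y 0)" for y by (simp add: g_def c_def)
  have rec: "c (t + 1) + c (t - 1) = 2 * cos \<theta> * c t" for t
  proof -
    have "c (t + 1) = cos (\<theta> * (real_of_int t + 1 / 2) + \<theta>)" "c (t - 1) = cos (\<theta> * (real_of_int t + 1 / 2) - \<theta>)"
      by (simp_all add: c_def algebra_simps)
    then show ?thesis by (simp add: cos_add cos_diff c_def)
  qed
  have left: "c (0 - 1) = c 0" by (simp add: c_def)
  have right: "c (int L + 1) = c (int L)"
  proof -
    have "\<theta> * (real_of_int (int L + 1) + 1 / 2) = pi + \<theta> / 2" "\<theta> * (real_of_int (int L) + 1 / 2) = pi - \<theta> / 2"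
      by (simp_all add: \<theta>_def field_simps)
    then show ?thesis by (simp only: c_def cos_add cos_diff) simp
  qed
  have x0: "0 \<le> x 0" "x 0 \<le> int L" using x d by (auto simp: box_vertices_def PiE_iff)
  have "laplacian (box_vertices d L) (edge_weight (box_edges d L)) g x =
     (\<Sum>i<d. if i = 0 then (if x 0 < int L then c (x 0) - c (x 0 + 1) else 0)
          + (if 0 < x 0 then c (x 0) - c (x 0 - 1) else 0) else 0)"
    unfolding laplacian_box[OF x] g by (intro sum.cong refl) auto
  also have "\<dots> = (if x 0 < int L then c (x 0) - c (x 0 + 1) else 0) + (if 0 < x 0 then c (x 0) - c (x 0 - 1) else 0)"
    using d by simp
  also have "\<dots> = (c (x 0) - c (x 0 + 1)) + (c (x 0) - c (x 0 - 1))"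
    using x0 left right by (cases "x 0 = 0"; cases "x 0 = int L") auto
  also have "\<dots> = (2 - 2 * cos \<theta>) * g x"
    using rec[of "x 0"] by (simp add: g algebra_simps)
  finally show ?thesis .
qed

lemma ip_gap_box_bounds:
  assumes "d \<ge> 1" "L \<ge> 1"
  shows "1 / box_const L \<le> ip_gap (box_vertices d L) (box_edges d L) \<and>
    ip_gap (box_vertices d L) (box_edges d L) \<le> 2 - 2 * cos (pi / real (L + 1))"
proof (rule ip_gap_bounds)
  let ?p = "\<lambda>i. if i < d then 0 else undefined :: int"
  let ?g = "\<lambda>x :: nat \<Rightarrow> int. cos (pi / real (L + 1) * (real_of_int (x 0) + 1 / 2))"
  show "finite (box_vertices d L)" by (rule finite_box_vertices)
  show "\<And>e. e \<in> box_edges d L \<Longrightarrow> \<exists>a\<in>box_vertices d L. \<exists>b\<in>box_vertices d L. a \<noteq> b \<and> e = {a, b}"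
    by (rule box_edges_doubleton)
  show "ip_poincare (box_vertices d L) (edge_weight (box_edges d L)) (box_const L)"
    unfolding box_vertices_eq_box by (rule ip_poincare_cube) simp
  show "box_const L > 0" by (rule box_const_pos)
  show "2 - 2 * cos (pi / real (L + 1)) > 0" using cos_pi_div_less_1[of "L + 1"] by simp
  show "?p \<in> box_vertices d L" by (auto simp: box_vertices_def PiE_iff extensional_def)
  have "cos (pi / real (L + 1) * (1 / 2)) > 0"
    using assms(2) by (intro cos_gt_zero) (auto simp: field_simps)
  then show "?g ?p \<noteq> 0" using assms(1) by simp
  show "\<And>x. x \<in> box_vertices d L \<Longrightarrow> laplacian (box_vertices d L) (edge_weight (box_edges d L)) ?g x =
      (2 - 2 * cos (pi / real (L + 1))) * ?g x"
    by (rule laplacian_box_cosine[OF assms(1)])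
qed

theorem corollary3:
  fixes d :: nat
  assumes "d \<ge> 1"
  shows "(\<lambda>L :: nat. (real L)\<^sup>2 / pi\<^sup>2 * ip_gap (box_vertices d L) (box_edges d L))
           \<longlonglongrightarrow> 1"
proof (rule tendsto_sandwich)
  let ?gap = "\<lambda>L. ip_gap (box_vertices d L) (box_edges d L)"
  show "\<forall>\<^sub>F L in sequentially. (real L)\<^sup>2 / pi\<^sup>2 * (1 / box_const L) \<le> (real L)\<^sup>2 / pi\<^sup>2 * ?gap L"
    using ip_gap_box_bounds[OF assms]
    by (intro eventually_mono[OF eventually_ge_at_top[of 1]] mult_left_mono) auto
  show "\<forall>\<^sub>F L in sequentially. (real L)\<^sup>2 / pi\<^sup>2 * ?gap L \<le> (real L)\<^sup>2 / pi\<^sup>2 * (2 - 2 * cos (pi / real (L + 1)))"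
    using ip_gap_box_bounds[OF assms]
    by (intro eventually_mono[OF eventually_ge_at_top[of 1]] mult_left_mono) auto
  show "(\<lambda>L. (real L)\<^sup>2 / pi\<^sup>2 * (1 / box_const L)) \<longlonglongrightarrow> 1"
    unfolding box_const_def path_const_def by real_asymp (simp add: field_simps power2_eq_square)
  show "(\<lambda>L. (real L)\<^sup>2 / pi\<^sup>2 * (2 - 2 * cos (pi / real (L + 1)))) \<longlonglongrightarrow> 1"
    by real_asymp (simp add: field_simps power2_eq_square)
qed

end
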